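(* There is a polynomial-time algorithm which, given any finite simple connected graph $G$ with $rc(G)=2$, outputs an edge-coloring $c:E(G)\to\{1,2,3,4,5\}$ (using at most 5 colors) under which $G$ is rainbow connected.
   Context: All graphs are finite, simple and undirected. For a connected graph $G$, an edge-coloring $c:E(G)\to\{1,\dots,k\}$ (adjacent edges may receive the same color) makes $G$ rainbow connected if for every pair of distinct vertices $u,v$ there is a $u$–$v$ path in $G$ whose edges all have distinct colors. The rainbow connection number $rc(G)$ is the minimum $k$ for which such a coloring exists. "Polynomial time" is measured in the number of vertices $n$ (and edges $m$) of $G$. *)

theory Defs
  imports "HOL-Computational_Algebra.Polynomial"
begin

section \<open>Graphs and rainbow connection\<close>

definition simple_graph :: "'a set \<Rightarrow> 'a set set \<Rightarrow> bool" where
  "simple_graph V E \<longleftrightarrow> finite V \<and> (\<forall>e\<in>E. e \<subseteq> V \<and> card e = 2)"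

fun path_edges :: "'a list \<Rightarrow> 'a set list" where
  "path_edges (x # y # xs) = {x, y} # path_edges (y # xs)"
| "path_edges _ = []"

definition is_path :: "'a set \<Rightarrow> 'a set set \<Rightarrow> 'a \<Rightarrow> 'a list \<Rightarrow> 'a \<Rightarrow> bool" where
  "is_path V E u p v \<longleftrightarrow>
     p \<noteq> [] \<and> hd p = u \<and> last p = v \<and> distinct p \<and> set p \<subseteq> V \<and> set (path_edges p) \<subseteq> E"

definition connected_graph :: "'a set \<Rightarrow> 'a set set \<Rightarrow> bool" where
  "connected_graph V E \<longleftrightarrow> V \<noteq> {} \<and> (\<forall>u\<in>V. \<forall>v\<in>V. \<exists>p. is_path V E u p v)"

definition rainbow_connected :: "'a set \<Rightarrow> 'a set set \<Rightarrow> ('a set \<Rightarrow> nat) \<Rightarrow> bool" where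
  "rainbow_connected V E c \<longleftrightarrow>
     (\<forall>u\<in>V. \<forall>v\<in>V. u \<noteq> v \<longrightarrow>
        (\<exists>p. is_path V E u p v \<and> distinct (map c (path_edges p))))"

text \<open>Only meaningful for connected graphs: otherwise no colouring qualifies.\<close>

definition rc :: "'a set \<Rightarrow> 'a set set \<Rightarrow> nat" where
  "rc V E = (LEAST k. \<exists>c. c ` E \<subseteq> {1..k} \<and> rainbow_connected V E c)"


section \<open>Model of computation\<close>

text \<open>
  Structured programs for a random access machine. The memory is a family of arrays of
  natural numbers; a program mentions only finitely many of them, by fixed names, but may
  compute indices (indirect addressing). Subtraction is truncated. There is deliberately no
  multiplication: each unit of time at most doubles the largest value (beyond the constants
  of the program), so numbers computed in time \<open>t\<close> exceed the input by only \<open>O(t)\<close> bits and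
  polynomial time in this model is the same as polynomial time on Turing machines.
\<close>

type_synonym memory = "nat \<Rightarrow> nat \<Rightarrow> nat"

datatype exp =
    Const nat
  | Get nat exp
  | Add exp exp
  | Sub exp exp

datatype com =
    Skip
  | Put nat exp exp
  | Seq com com
  | If exp com com
  | While exp com

fun val :: "exp \<Rightarrow> memory \<Rightarrow> nat" where
  "val (Const k) s = k"
| "val (Get a e) s = s a (val e s)"
| "val (Add d e) s = val d s + val e s"
| "val (Sub d e) s = val d s - val e s"

fun cost :: "exp \<Rightarrow> nat" where
  "cost (Const k) = 1"
| "cost (Get a e) = 1 + cost e"
| "cost (Add d e) = 1 + cost d + cost e"
| "cost (Sub d e) = 1 + cost d + cost e"

definition put :: "memory \<Rightarrow> nat \<Rightarrow> nat \<Rightarrow> nat \<Rightarrow> memory" where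
  "put s a i x = s(a := (s a)(i := x))"

text \<open>
  \<open>exec p s t s'\<close>: started in memory \<open>s\<close>, the program \<open>p\<close> halts after exactly \<open>t\<close> units of
  time in memory \<open>s'\<close>. Tests succeed on nonzero values.
\<close>

inductive exec :: "com \<Rightarrow> memory \<Rightarrow> nat \<Rightarrow> memory \<Rightarrow> bool" where
  Skip: "exec Skip s 1 s"
| Put: "exec (Put a d e) s (1 + cost d + cost e) (put s a (val d s) (val e s))"
| Seq: "exec p s t s' \<Longrightarrow> exec q s' u s'' \<Longrightarrow> exec (Seq p q) s (t + u) s''"
| IfTrue: "val e s \<noteq> 0 \<Longrightarrow> exec p s t s' \<Longrightarrow> exec (If e p q) s (1 + cost e + t) s'"
| IfFalse: "val e s = 0 \<Longrightarrow> exec q s t s' \<Longrightarrow> exec (If e p q) s (1 + cost e + t) s'"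
| WhileFalse: "val e s = 0 \<Longrightarrow> exec (While e p) s (1 + cost e) s"
| WhileTrue: "val e s \<noteq> 0 \<Longrightarrow> exec p s t s' \<Longrightarrow> exec (While e p) s' u s'' \<Longrightarrow>
    exec (While e p) s (1 + cost e + t + u) s''"

inductive_cases Skip_elim: "exec Skip s t s'"
inductive_cases Put_elim: "exec (Put a d e) s t s'"
inductive_cases Seq_elim: "exec (Seq p q) s t s'"
inductive_cases If_elim: "exec (If e p q) s t s'"
inductive_cases While_elim: "exec (While e p) s t s'"

lemma exec_deterministic:
  "exec p s t s' \<Longrightarrow> exec p s u s'' \<Longrightarrow> u = t \<and> s'' = s'"
proof (induction arbitrary: u s'' rule: exec.induct)
  case (Skip s)
  then show ?case by (auto elim: Skip_elim)
next
  case (Put a d e s)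
  then show ?case by (auto elim: Put_elim)
next
  case (Seq p s t s' q v s2)
  from Seq.prems obtain t1 s1 t2 where
    "exec p s t1 s1" "exec q s1 t2 s''" "u = t1 + t2"
    by (auto elim: Seq_elim)
  with Seq.IH(1)[of t1 s1] Seq.IH(2)[of t2 s''] show ?case by simp
next
  case (IfTrue e s p t s' q)
  from IfTrue.prems IfTrue.hyps(1) obtain t1 where
    "exec p s t1 s''" "u = 1 + cost e + t1"
    by (auto elim: If_elim)
  with IfTrue.IH[of t1 s''] show ?case by simp
next
  case (IfFalse e s q t s' p)
  from IfFalse.prems IfFalse.hyps(1) obtain t1 where
    "exec q s t1 s''" "u = 1 + cost e + t1"
    by (auto elim: If_elim)
  with IfFalse.IH[of t1 s''] show ?case by simp
next
  case (WhileFalse e s p)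
  then show ?case by (auto elim: While_elim)
next
  case (WhileTrue e s p t s' v s2)
  from WhileTrue.prems WhileTrue.hyps(1) obtain t1 s1 t2 where
    "exec p s t1 s1" "exec (While e p) s1 t2 s''" "u = 1 + cost e + t1 + t2"
    by (auto elim: While_elim)
  with WhileTrue.IH(1)[of t1 s1] WhileTrue.IH(2)[of t2 s''] show ?case by simp
qed


section \<open>Encoding of graphs and colourings\<close>

text \<open>
  A graph with vertex set \<open>{..<n}\<close> is presented by \<open>n\<close> in cell 0 of array 0 and by its
  adjacency matrix, row by row, in array 1; all other cells are 0.
\<close>

definition input :: "nat \<Rightarrow> nat set set \<Rightarrow> memory" where
  "input n E = (\<lambda>a i.
     if a = 0 \<and> i = 0 then n
     else if a = 1 \<and> (\<exists>u<n. \<exists>v<n. i = u * n + v \<and> {u, v} \<in> E) then 1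
     else 0)"

text \<open>The colour of the edge \<open>{u, v}\<close> with \<open>u < v\<close> is read off at index \<open>u * n + v\<close> of array 2.\<close>

definition output_coloring :: "nat \<Rightarrow> memory \<Rightarrow> nat set \<Rightarrow> nat" where
  "output_coloring n s e = s 2 (Min e * n + Max e)"

end

theory Submission
  imports Defs
begin

text \<open>
  Since \<open>rc G = 2\<close>, any two non-adjacent vertices have a common neighbour. Let \<open>v\<close> be a vertex of
  maximum degree, \<open>N\<close> its neighbourhood and \<open>D\<close> the set of remaining vertices.

  If \<open>D\<close> is non-empty, some \<open>x \<in> N\<close> has a neighbour in \<open>D\<close>. Split \<open>N\<close> into a maximal clique \<open>X\<close>
  containing \<open>x\<close> and the rest \<open>Y\<close>, and colour the edges \<open>v\<close>--\<open>X\<close>, \<open>v\<close>--\<open>Y\<close>, \<open>X\<close>--\<open>D\<close>, \<open>Y\<close>--\<open>D\<close> by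
  1, 2, 3, 4 and all others by 5, so that rainbow paths can run through \<open>v\<close>, down into \<open>X\<close> on one side and into \<open>Y\<close>
  on the other. A vertex \<open>w \<in> N\<close> with a neighbour in \<open>D\<close> has a non-neighbour on the opposite side of \<open>N\<close>:
  otherwise \<open>w\<close> would be adjacent to \<open>v\<close>, to all of \<open>N\<close> and to a vertex of \<open>D\<close>, against the maximality
  of the degree of \<open>v\<close>. The only problem is a \<open>d \<in> D\<close> that has neighbours on one side only, as do all
  its neighbours in \<open>D\<close>. By the previous remark such a \<open>d\<close> has at least two neighbours in \<open>N\<close>, and
  it has one with a neighbour on the opposite side; recolouring the edge from \<open>d\<close> to this vertex with the other one
  of 3 and 4 opens a second route to \<open>v\<close>.

  If \<open>D\<close> is empty, at most two vertices are leaves, because a rainbow colouring with two colours exists.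
  They get private colours 3 and 4, and a maximal independent set of \<open>G - v\<close> splits the
  other vertices into two sides such that every vertex has a neighbour on the opposite side.

  Maximal cliques and independent sets are found greedily. The algorithm is written in a small language of
  arrays, bounded sums and bounded loops, every program of which runs in polynomial time.
\<close>

section \<open>Rainbow paths\<close>

definition rainbow_joined :: "'a set \<Rightarrow> 'a set set \<Rightarrow> ('a set \<Rightarrow> nat) \<Rightarrow> 'a \<Rightarrow> 'a \<Rightarrow> bool" where
  "rainbow_joined V E c u w \<longleftrightarrow> (\<exists>p. is_path V E u p w \<and> distinct (map c (path_edges p)))"

lemma path_edges_append:
  "path_edges (xs @ [x, y]) = path_edges (xs @ [x]) @ [{x, y}]"
  by (induction xs rule: path_edges.induct) auto

lemma path_edges_rev: "path_edges (rev p) = rev (path_edges p)"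
  by (induction p rule: path_edges.induct) (auto simp: path_edges_append insert_commute)

lemma rainbow_joined_sym:
  assumes "rainbow_joined V E c u w" shows "rainbow_joined V E c w u"
proof -
  obtain p where p: "is_path V E u p w" "distinct (map c (path_edges p))"
    using assms by (auto simp: rainbow_joined_def)
  have "is_path V E w (rev p) u" "distinct (map c (path_edges (rev p)))"
    using p by (auto simp: is_path_def path_edges_rev hd_rev last_rev rev_map[symmetric])
  then show ?thesis by (auto simp: rainbow_joined_def)
qed

lemma path_edges_covers: "length p \<ge> 2 \<Longrightarrow> \<Union> (set (path_edges p)) = set p"
proof (induction p rule: path_edges.induct)
  case (1 x y xs)
  then show ?case by (cases xs) auto
qed auto

text \<open>With at least one edge on the path, every vertex of it lies on an edge, so membership in
  \<open>V\<close> follows from the edges alone.\<close>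

lemma rainbow_joinedI:
  assumes "\<forall>e\<in>E. e \<subseteq> V" "length p \<ge> 2" "distinct p" "set (path_edges p) \<subseteq> E"
    "distinct (map c (path_edges p))"
  shows "rainbow_joined V E c (hd p) (last p)"
  using assms path_edges_covers[OF assms(2)] unfolding rainbow_joined_def is_path_def
  by (intro exI[of _ p]) fastforce

lemma path_edges_subset_verts: "e \<in> set (path_edges p) \<Longrightarrow> e \<subseteq> set p"
  by (induction p rule: path_edges.induct) auto

lemma distinct_path_edges: "distinct p \<Longrightarrow> distinct (path_edges p)"
  by (induction p rule: path_edges.induct) (auto dest: path_edges_subset_verts)

lemma length_path_edges: "length (path_edges p) = length p - 1"
  by (induction p rule: path_edges.induct) auto

section \<open>Optimal colourings and rainbow paths in two colours\<close>

text \<open>Giving every edge its own colour makes any path rainbow, so the set whose least element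
  defines \<open>rc\<close> is non-empty.\<close>

lemma rc_attained:
  assumes "simple_graph V E" "connected_graph V E"
  shows "\<exists>c. c ` E \<subseteq> {1..rc V E} \<and> rainbow_connected V E c"
proof -
  have "finite E"
    using assms(1) by (intro finite_subset[of E "Pow V"]) (auto simp: simple_graph_def)
  then obtain f :: "'a set \<Rightarrow> nat" where f: "bij_betw f E {..<card E}"
    using ex_bij_betw_finite_nat atLeast0LessThan by metis
  let ?c = "Suc \<circ> f"
  have "?c ` E \<subseteq> {1..card E}"
    using f by (force simp: bij_betw_def Suc_le_eq)
  moreover have "rainbow_connected V E ?c"
    unfolding rainbow_connected_def
  proof (intro ballI impI)
    fix u w assume "u \<in> V" "w \<in> V"
    then obtain p where p: "is_path V E u p w"
      using assms(2) by (auto simp: connected_graph_def)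
    have "inj_on ?c (set (path_edges p))"
      using f p by (auto simp: bij_betw_def is_path_def intro!: comp_inj_on inj_on_subset[of f E])
    then have "distinct (map ?c (path_edges p))"
      using p by (auto simp: distinct_map is_path_def distinct_path_edges)
    with p show "\<exists>p. is_path V E u p w \<and> distinct (map ?c (path_edges p))" by blast
  qed
  ultimately show ?thesis
    unfolding rc_def by (intro LeastI[of "\<lambda>k. \<exists>c. c ` E \<subseteq> {1..k} \<and> rainbow_connected V E c"]) blast
qed

text \<open>A rainbow path in two colours has at most two edges; between distinct non-adjacent
  vertices it has exactly two.\<close>

lemma rainbow_two_colors:
  assumes "c ` E \<subseteq> {1..2}" "rainbow_connected V E c" "u \<in> V" "w \<in> V" "u \<noteq> w" "{u, w} \<notin> E"
  shows "\<exists>z\<in>V. {u, z} \<in> E \<and> {z, w} \<in> E \<and> c {u, z} \<noteq> c {z, w}"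
proof -
  obtain p where p: "is_path V E u p w" "distinct (map c (path_edges p))"
    using assms unfolding rainbow_connected_def by meson
  have "set (map c (path_edges p)) \<subseteq> {1..2}"
    using p(1) assms(1) by (auto simp: is_path_def)
  then have "card (set (map c (path_edges p))) \<le> card {1..2::nat}"
    by (intro card_mono) auto
  then have "length (path_edges p) \<le> 2"
    unfolding distinct_card[OF p(2)] by simp
  then have len: "length p \<le> 3"
    by (simp add: length_path_edges)
  consider a where "p = [a]" | a b where "p = [a, b]" | a b d where "p = [a, b, d]"
  proof (cases p rule: path_edges.cases)
    case (1 x y xs)
    then show ?thesis using len that by (cases xs) auto
  qed (use p(1) that in \<open>auto simp: is_path_def\<close>)
  then show ?thesis
    using p assms by cases (auto simp: is_path_def)
qed

section \<open>Graphs of diameter at most two\<close>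

text \<open>The structural consequence of a rainbow colouring with two colours: non-adjacent
  vertices have a common neighbour.\<close>

locale diameter_two =
  fixes V :: "'a set" and E :: "'a set set"
  assumes simple: "simple_graph V E"
    and two_step: "\<And>u w. \<lbrakk>u \<in> V; w \<in> V; u \<noteq> w; {u, w} \<notin> E\<rbrakk> \<Longrightarrow> \<exists>z\<in>V. {u, z} \<in> E \<and> {z, w} \<in> E"
begin

lemma edge_verts: "{u, w} \<in> E \<Longrightarrow> u \<in> V \<and> w \<in> V \<and> u \<noteq> w"
  using simple by (fastforce simp: simple_graph_def)

lemma join:
  assumes "hd p = u" "last p = w" "length p \<ge> 2" "distinct p" "set (path_edges p) \<subseteq> E"
    "distinct (map c (path_edges p))"
  shows "rainbow_joined V E c u w"
  using rainbow_joinedI[OF _ assms(3-6)] assms(1,2) simple by (auto simp: simple_graph_def)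

lemma edge_sym: "{u, w} \<in> E \<Longrightarrow> {w, u} \<in> E"
  by (simp add: insert_commute)

end

text \<open>The labels encode the partition of the vertices: 0 is the root, 1 and 2 are the two sides of its
  neighbourhood, and 5 marks the vertices at distance two. \<open>flip d w\<close> says that the colour of the edge from the
  outer vertex \<open>d\<close> to \<open>w\<close> is changed.\<close>

locale layered = diameter_two +
  fixes v :: 'a and lab :: "'a \<Rightarrow> nat" and flip :: "'a \<Rightarrow> 'a \<Rightarrow> bool" and c :: "'a set \<Rightarrow> nat"
    and x0 d0 :: 'a
  assumes v: "v \<in> V"
    and lab0: "\<And>w. w \<in> V \<Longrightarrow> lab w = 0 \<longleftrightarrow> w = v"
    and labN: "\<And>w. w \<in> V \<Longrightarrow> lab w \<in> {1, 2} \<longleftrightarrow> {v, w} \<in> E"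
    and labs: "\<And>w. w \<in> V \<Longrightarrow> lab w \<in> {0, 1, 2, 5}"
    and clique: "\<And>x y. \<lbrakk>x \<in> V; y \<in> V; lab x = 1; lab y = 1; x \<noteq> y\<rbrakk> \<Longrightarrow> {x, y} \<in> E"
    and opposite: "\<And>w d. \<lbrakk>{d, w} \<in> E; lab d = 5; lab w \<in> {1, 2}\<rbrakk> \<Longrightarrow>
        \<exists>z\<in>V. lab z = 3 - lab w \<and> {w, z} \<notin> E"
    and touch: "{d0, x0} \<in> E" "lab d0 = 5" "lab x0 = 1"
    and flip_unique: "\<And>d w w'. flip d w \<Longrightarrow> flip d w' \<Longrightarrow> w = w'"
    and ex_flip: "\<And>d w z. \<lbrakk>lab d = 5; lab w \<in> {1, 2}; {d, w} \<in> E; {w, z} \<in> E; lab z = 3 - lab w;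
        \<And>z d'. lab z = 3 - lab w \<Longrightarrow> {d, z} \<notin> E \<and> \<not> (lab d' = 5 \<and> {d, d'} \<in> E \<and> {d', z} \<in> E)\<rbrakk>
        \<Longrightarrow> \<exists>w'. flip d w'"
    and flip: "\<And>d w. flip d w \<Longrightarrow> lab d = 5 \<and> lab w \<in> {1, 2} \<and> {d, w} \<in> E \<and>
        (\<exists>z. {w, z} \<in> E \<and> lab z = 3 - lab w) \<and>
        (\<forall>z d'. lab z = 3 - lab w \<longrightarrow> {d, z} \<notin> E \<and> \<not> (lab d' = 5 \<and> {d, d'} \<in> E \<and> {d', z} \<in> E))"
    and c_root: "\<And>w. {v, w} \<in> E \<Longrightarrow> c {v, w} = lab w"
    and c_flat: "\<And>w z. \<lbrakk>{w, z} \<in> E; w \<noteq> v; z \<noteq> v; lab w = 5 \<longleftrightarrow> lab z = 5\<rbrakk> \<Longrightarrow> c {w, z} = 5"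
    and c_down: "\<And>d w. \<lbrakk>{d, w} \<in> E; lab d = 5; lab w \<in> {1, 2}\<rbrakk> \<Longrightarrow>
        c {d, w} = (if flip d w then 5 - lab w else 2 + lab w)"
begin

section \<open>Rainbow paths when some vertex has distance two from the root\<close>

definition near :: "nat \<Rightarrow> 'a \<Rightarrow> bool" where
  "near s d \<longleftrightarrow> (\<exists>z. lab z = s \<and> {d, z} \<in> E)"

abbreviation (input) joined :: "'a \<Rightarrow> 'a \<Rightarrow> bool" where
  "joined \<equiv> rainbow_joined V E c"

lemma c_sym: "c {u, w} = k \<Longrightarrow> c {w, u} = k"
  by (simp add: insert_commute)

lemma root_edge: "w \<in> V \<Longrightarrow> lab w \<in> {1, 2} \<Longrightarrow> {v, w} \<in> E \<and> {w, v} \<in> E \<and> c {v, w} = lab w \<and> c {w, v} = lab w"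
  using labN c_root edge_sym c_sym by metis

lemma not_root: "w \<in> V \<Longrightarrow> lab w \<noteq> 0 \<Longrightarrow> w \<noteq> v"
  using lab0 by auto

lemma lab_v: "lab v = 0"
  using lab0 v by auto

text \<open>An outer vertex is not adjacent to \<open>v\<close>, and a common neighbour of the two
  lies on one of the sides.\<close>

lemma near_parent: 
  assumes "d \<in> V" "lab d = 5" shows "near 1 d \<or> near 2 d"
proof -
  have "{v, d} \<notin> E" "d \<noteq> v"
    using assms labN lab0 by force+
  then obtain z where "z \<in> V" "{d, z} \<in> E" "{z, v} \<in> E"
    using two_step[of d v] assms v edge_sym by metis
  then show ?thesis
    using labN[of z] edge_sym[of z v] by (auto simp: near_def)
qed

text \<open>Take a non-neighbour \<open>z\<close> of \<open>w\<close> on the opposite side. A common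
  neighbour of \<open>d\<close> and \<open>z\<close> can be neither the root, nor outer, nor on the
  opposite side; so it is on the side of \<open>w\<close>, and it differs from \<open>w\<close>
  because \<open>w\<close> is not adjacent to \<open>z\<close>.\<close>

lemma two_parents:
  assumes "{d, w} \<in> E" "lab d = 5" "lab w \<in> {1, 2}"
    "\<not> near (3 - lab w) d" "\<And>e. {d, e} \<in> E \<Longrightarrow> lab e = 5 \<Longrightarrow> \<not> near (3 - lab w) e"
  shows "\<exists>w'. w' \<noteq> w \<and> {d, w'} \<in> E \<and> lab w' = lab w"
proof -
  obtain z where z: "z \<in> V" "lab z = 3 - lab w" "{w, z} \<notin> E"
    using opposite assms by blast
  have "d \<in> V" using edge_verts assms(1) by auto
  moreover have "{d, z} \<notin> E" using assms(4) z by (auto simp: near_def)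
  moreover have "d \<noteq> z" using z assms by auto
  ultimately obtain w' where w': "{d, w'} \<in> E" "{w', z} \<in> E"
    using two_step z by metis
  have "w' \<in> V" using edge_verts w' by auto
  have "lab w' \<noteq> 5" using w' assms(5) z by (auto simp: near_def)
  moreover have "lab w' \<noteq> 3 - lab w" using assms(4) w' by (auto simp: near_def)
  moreover have "lab w' \<noteq> 0"
  proof
    assume "lab w' = 0"
    then have "w' = v" using lab0 \<open>w' \<in> V\<close> by auto
    then show False using w' labN[OF \<open>d \<in> V\<close>] assms(2) edge_sym[of d v] by auto
  qed
  ultimately have "lab w' = lab w"
    using labs[OF \<open>w' \<in> V\<close>] assms(3) by auto
  then show ?thesis using w' z by auto
qed

text \<open>A detached outer vertex only sees the side \<open>s\<close>, even through its outer neighbours. It is the only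
  kind of vertex with a recoloured edge.\<close>

definition detached :: "nat \<Rightarrow> 'a \<Rightarrow> bool" where
  "detached s d \<longleftrightarrow> \<not> near (3 - s) d \<and> (\<forall>e. {d, e} \<in> E \<longrightarrow> lab e = 5 \<longrightarrow> \<not> near (3 - s) e)"

lemma flip_detached: "flip d w \<Longrightarrow> detached (lab w) d"
  using flip[of d w] by (auto simp: detached_def near_def)

text \<open>Recolouring never uses up a side: a recoloured edge leaves a detached vertex, which has
  a second parent on the same side, and only one edge per outer vertex is recoloured.\<close>

lemma plain_edge:
  assumes "d \<in> V" "lab d = 5" "near s d" "s \<in> {1, 2}"
  shows "\<exists>w. lab w = s \<and> {d, w} \<in> E \<and> c {d, w} = 2 + s"
proof -
  obtain w where w: "lab w = s" "{d, w} \<in> E" using assms by (auto simp: near_def)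
  show ?thesis
  proof (cases "flip d w")
    case True
    then obtain w' where w': "w' \<noteq> w" "{d, w'} \<in> E" "lab w' = s"
      using two_parents[of d w] flip_detached[of d w] w assms by (auto simp: detached_def)
    then have "\<not> flip d w'" using flip_unique[OF True] by auto
    then show ?thesis using w' c_down[of d w'] assms by (intro exI[of _ w']) auto
  next
    case False
    then show ?thesis using w c_down[of d w] assms by auto
  qed
qed

lemma no_flip: 
  assumes "{d, w} \<in> E" "lab d = 5" "lab w = s" "s \<in> {1, 2}" "\<not> detached s d"
  shows "c {d, w} = 2 + s"
  using assms flip_detached c_down[of d w] by auto

text \<open>Side 1 contains \<open>x0\<close>, and side 2 contains a non-neighbour of
  \<open>x0\<close>.\<close>

lemma opposite_ex: "s \<in> {1, 2} \<Longrightarrow> \<exists>y\<in>V. lab y = s"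
  using opposite[OF touch(1) touch(2)] touch(3) edge_verts[OF touch(1)] by auto

text \<open>A common neighbour of \<open>d\<close> and any vertex of the opposite side must lie on
  side \<open>s\<close>. It is a candidate for recolouring, so \<open>ex_flip\<close> supplies a
  recoloured edge.\<close>

lemma detached_edge:
  assumes "d \<in> V" "lab d = 5" "detached s d" "s \<in> {1, 2}"
  shows "\<exists>w y. lab w = s \<and> {d, w} \<in> E \<and> c {d, w} = 5 - s \<and> {w, y} \<in> E \<and> lab y = 3 - s"
proof -
  obtain y where y: "y \<in> V" "lab y = 3 - s"
    using opposite_ex[of "3 - s"] assms(4) by auto
  have "{d, y} \<notin> E" "d \<noteq> y"
    using assms y by (auto simp: detached_def near_def)
  then obtain w where w: "w \<in> V" "{d, w} \<in> E" "{w, y} \<in> E"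
    using two_step y assms by metis
  have "lab w \<noteq> 5" "lab w \<noteq> 3 - s" using w assms y by (auto simp: detached_def near_def)
  moreover have "w \<noteq> v" using edge_sym[OF w(2)] labN[of d] assms by auto
  ultimately have "lab w = s" using labs[of w] lab0[of w] w assms(4) by auto
  have "\<exists>w. flip d w"
    using w assms y \<open>lab w = s\<close> by (intro ex_flip[of d w y]) (auto simp: detached_def near_def)
  then obtain w' where w': "flip d w'" by blast
  have "lab w' = s"
    using flip[OF w'] assms by (auto simp: detached_def near_def)
  then show ?thesis
    using flip[OF w'] c_down[of d w'] w' by auto
qed

text \<open>Different sides meet in \<open>v\<close>. Two non-adjacent vertices on the same side are
  on side 2, as side 1 is a clique; then \<open>x\<close> has to reach side 1, either by a flat edge
  or through the outer vertex \<open>d0\<close> and its parent \<open>x0\<close>.\<close>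

lemma joined_inner:
  assumes "x \<in> V" "y \<in> V" "x \<noteq> y" "lab x \<in> {1, 2}" "lab y \<in> {1, 2}" "{x, y} \<notin> E"
  shows "joined x y"
proof (cases "lab x = lab y")
  case False
  then show ?thesis
    using assms root_edge[of x] root_edge[of y] not_root by (intro join[of "[x, v, y]"]) auto
next
  case True
  then have lab2: "lab x = 2" "lab y = 2" using assms clique by auto
  note r = root_edge[of y] root_edge[of x0] not_root[of y] not_root[of x0] not_root[of x]
    not_root[of d0] lab_v
  have V0: "d0 \<in> V" "x0 \<in> V" using touch edge_verts by auto
  have n0: "near 1 d0" using touch by (auto simp: near_def)
  show ?thesis
  proof (cases "{x, d0} \<in> E")
    case True
    \<comment> \<open>Seeing both sides, \<open>d0\<close> is not detached, so its edges carry the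
      plain colours; the path has colours 4, 3, 1, 2.\<close>
    then have "near 2 d0" using lab2 edge_sym by (auto simp: near_def)
    with n0 have "c {d0, x0} = 3" "c {d0, x} = 4"
      using edge_sym[OF True] touch lab2 no_flip[of d0 x0 1] no_flip[of d0 x 2]
      by (auto simp: detached_def)
    with c_sym[of d0 x 4] show ?thesis
      using r V0 touch lab2 True assms by (intro join[of "[x, d0, x0, v, y]"]) auto
  next
    case False
    \<comment> \<open>A common neighbour of \<open>x\<close> and \<open>d0\<close> replaces the
      missing edge. If it is outer, the colours are 4, 5, 3, 1, 2; if it is on side 1, the path goes
      straight to \<open>v\<close> with 5, 1, 2; if it is on side 2, they are 5, 4, 3, 1, 2.\<close>
    then obtain w where w: "w \<in> V" "{x, w} \<in> E" "{w, d0} \<in> E"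
      using two_step[of x d0] V0 assms(1) lab2 touch(2) by fastforce
    have "w \<noteq> v" using w(3) labN V0 touch by force
    then consider "lab w = 5" | "lab w = 1" | "lab w = 2"
      using labs[of w] lab0[of w] w by auto
    then show ?thesis
    proof cases
      case 1
      have "near 2 w" using edge_sym[OF w(2)] lab2 by (auto simp: near_def)
      then have "c {d0, x0} = 3" "c {w, x} = 4"
        using w edge_sym[OF w(2)] edge_sym[OF w(3)] 1 touch n0 lab2 no_flip[of d0 x0 1] no_flip[of w x 2]
        by (auto simp: detached_def)
      moreover have "c {w, d0} = 5" using c_flat[of w d0] w 1 touch r V0 \<open>w \<noteq> v\<close> by auto
      moreover note c_sym[of w x 4]
      ultimately show ?thesis
        using r V0 touch lab2 assms w 1 edge_verts[OF w(3)] False by (intro join[of "[x, w, d0, x0, v, y]"]) auto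
    next
      case 2
      have "c {x, w} = 5" using c_flat[of x w] w 2 lab2 assms r \<open>w \<noteq> v\<close> by auto
      then show ?thesis
        using r lab2 assms w 2 root_edge[of w] by (intro join[of "[x, w, v, y]"]) auto
    next
      case 3
      have "c {x, w} = 5" using c_flat[of x w] w 3 lab2 assms r \<open>w \<noteq> v\<close> by auto
      moreover have "near 2 d0" using 3 edge_sym[OF w(3)] by (auto simp: near_def)
      with n0 have "c {d0, x0} = 3" "c {d0, w} = 4"
        using edge_sym[OF w(3)] 3 touch lab2 no_flip[of d0 x0 1] no_flip[of d0 w 2]
        by (auto simp: detached_def)
      moreover note c_sym[of d0 w 4]
      moreover have "w \<noteq> y" "x \<noteq> w" using w assms edge_verts[OF w(2)] by auto
      ultimately show ?thesis
        using r V0 touch lab2 assms w 3 by (intro join[of "[x, w, d0, x0, v, y]"]) auto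
    qed
  qed
qed

text \<open>The last edge has colour \<open>s\<close>, so \<open>v\<close> must be entered from side
  \<open>3 - s\<close>. That side is reached through a parent, through an outer neighbour, or, for
  detached \<open>d\<close>, over the recoloured edge and a flat edge; these use only colours 5 and
  \<open>5 - s\<close>.\<close>

lemma joined_inner_outer:
  assumes "x \<in> V" "d \<in> V" "lab x = s" "s \<in> {1, 2}" "lab d = 5" "{d, x} \<notin> E"
  shows "joined d x"
proof -
  note r = root_edge[of x] not_root[of x] not_root[of d] lab_v
  consider "near (3 - s) d" | e where "{d, e} \<in> E" "lab e = 5" "near (3 - s) e" | "detached s d"
    by (auto simp: detached_def)
  then show ?thesis
  proof cases
    case 1
    then obtain y where y: "lab y = 3 - s" "{d, y} \<in> E" "c {d, y} = 2 + (3 - s)"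
      using plain_edge[of d "3 - s"] assms by auto
    then show ?thesis
      using r root_edge[of y] edge_verts[OF y(2)] assms by (intro join[of "[d, y, v, x]"]) auto
  next
    case 2
    have e: "e \<in> V" "d \<noteq> e" using edge_verts[OF 2(1)] by auto
    then obtain y where y: "lab y = 3 - s" "{e, y} \<in> E" "c {e, y} = 2 + (3 - s)"
      using plain_edge[of e "3 - s"] assms 2 by auto
    moreover have "c {d, e} = 5" using c_flat[of d e] 2 e not_root[of e] assms r by auto
    ultimately show ?thesis
      using 2 e r root_edge[of y] edge_verts[OF y(2)] not_root[of e] assms by (intro join[of "[d, e, y, v, x]"]) auto
  next
    case 3
    then obtain w y where w: "lab w = s" "{d, w} \<in> E" "c {d, w} = 5 - s" "{w, y} \<in> E" "lab y = 3 - s"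
      using detached_edge[of d s] assms by auto
    have wy: "w \<in> V" "y \<in> V" using edge_verts[OF w(4)] by auto
    have "c {w, y} = 5"
      using c_flat[of w y] w assms not_root[of w] not_root[of y] wy by auto
    then show ?thesis
      using r root_edge[of y] w wy not_root[of w] not_root[of y] assms by (intro join[of "[d, w, y, v, x]"]) auto
  qed
qed

text \<open>The detour of \<open>d\<close> through \<open>f\<close> puts the two descents on
  different sides; the path has colours \<open>5\<close>, \<open>5 - s\<close>,
  \<open>3 - s\<close>, \<open>s\<close>, \<open>2 + s\<close>.\<close>

lemma joined_outer_same:
  assumes "d \<in> V" "e \<in> V" "d \<noteq> e" "lab d = 5" "lab e = 5" "s \<in> {1, 2}"
    "\<not> near (3 - s) d" "\<not> near (3 - s) e"
    and far: "{d, f} \<in> E" "lab f = 5" "near (3 - s) f"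
  shows "joined d e"
proof -
  have f: "f \<in> V" "d \<noteq> f" "f \<noteq> e" using edge_verts[OF far(1)] assms by auto
  have nd: "near s d" "near s e" using near_parent[of d] near_parent[of e] assms by auto
  obtain y where y: "lab y = 3 - s" "{f, y} \<in> E" "c {f, y} = 2 + (3 - s)"
    using plain_edge[of f "3 - s"] f far assms by auto
  obtain x where x: "lab x = s" "{e, x} \<in> E" "c {e, x} = 2 + s"
    using plain_edge[of e s] nd assms by auto
  have xy: "x \<in> V" "y \<in> V" using edge_verts[OF x(2)] edge_verts[OF y(2)] by auto
  have "c {d, f} = 5" using c_flat[of d f] far f assms not_root[of d] not_root[of f] by auto
  moreover note edge_sym[OF x(2)] c_sym[OF x(3)]
  ultimately show ?thesis
    using x y xy f far assms root_edge[of x] root_edge[of y]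
      not_root[of d] not_root[of f] not_root[of e] lab_v by (intro join[of "[d, f, y, v, x, e]"]) auto
qed

text \<open>If the two vertices have parents on different sides, plain edges and \<open>v\<close>
  suffice. Otherwise both see the same single side, and one of them must cross over through an outer
  neighbour or a recoloured edge.\<close>

lemma joined_outer:
  assumes "d \<in> V" "e \<in> V" "d \<noteq> e" "lab d = 5" "lab e = 5"
  shows "joined d e"
proof -
  have cross: "joined d e" if s: "near s d" "near (3 - s) e" "s \<in> {1, 2}" for s
  proof -
    obtain x where x: "lab x = s" "{d, x} \<in> E" "c {d, x} = 2 + s"
      using plain_edge[of d s] s assms by auto
    obtain y where y: "lab y = 3 - s" "{e, y} \<in> E" "c {e, y} = 2 + (3 - s)"
      using plain_edge[of e "3 - s"] s assms by auto
    have xy: "x \<in> V" "y \<in> V" using edge_verts[OF x(2)] edge_verts[OF y(2)] by auto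
    note edge_sym[OF y(2)] c_sym[OF y(3)]
    then show ?thesis
      using x y xy assms s root_edge[of x] root_edge[of y]
        not_root[of d] not_root[of e] lab_v by (intro join[of "[d, x, v, y, e]"]) auto
  qed
  have same: "joined d e" if s: "s \<in> {1, 2}" "\<not> near (3 - s) d" "\<not> near (3 - s) e" for s
  proof -
    consider f where "{d, f} \<in> E" "lab f = 5" "near (3 - s) f"
      | f where "{e, f} \<in> E" "lab f = 5" "near (3 - s) f"
      | "detached s d" "detached s e"
      using s by (auto simp: detached_def)
    then show ?thesis
    proof cases
      case 1
      then show ?thesis using joined_outer_same[of d e s f] assms s by auto
    next
      case 2
      then have "joined e d" using joined_outer_same[of e d s f] assms s by auto
      then show ?thesis by (rule rainbow_joined_sym)
    next
      case 3
      have "near s d" using near_parent[of d] assms s by auto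
      then obtain x where x: "lab x = s" "{d, x} \<in> E" "c {d, x} = 2 + s"
        using plain_edge[of d s] assms s by auto
      obtain w y where w: "lab w = s" "{e, w} \<in> E" "c {e, w} = 5 - s" "{w, y} \<in> E" "lab y = 3 - s"
        using detached_edge[of e s] assms s 3 by auto
      have V: "x \<in> V" "w \<in> V" "y \<in> V"
        using edge_verts[OF x(2)] edge_verts[OF w(4)] by auto
      have cwy: "c {w, y} = 5"
        using c_flat[of w y] w V not_root[of w] not_root[of y] s by auto
      note sw = edge_sym[OF w(2)] edge_sym[OF w(4)] c_sym[OF w(3)] c_sym[OF cwy]
      show ?thesis
      \<comment> \<open>If the plain edge of \<open>d\<close> and the recoloured edge of
        \<open>e\<close> share a parent, colours \<open>2 + s\<close> and \<open>5 - s\<close>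
        already give a path; otherwise the longer path has colours \<open>2 + s\<close>,
        \<open>s\<close>, \<open>3 - s\<close>, \<open>5\<close>, \<open>5 - s\<close>.\<close>
      proof (cases "x = w")
        case True
        then show ?thesis
          using x w V assms s sw by (intro join[of "[d, x, e]"]) auto
      next
        case False
        then show ?thesis
          using x w V assms s sw cwy root_edge[of x] root_edge[of y]
            not_root[of d] not_root[of w] not_root[of e] lab_v by (intro join[of "[d, x, v, y, w, e]"]) auto
      qed
    qed
  qed
  show ?thesis
  proof (cases "near 1 d \<and> near 2 e \<or> near 2 d \<and> near 1 e")
    case True
    then show ?thesis using cross[of 1] cross[of 2] by auto
  next
    case False
    then have "\<not> near 2 d \<and> \<not> near 2 e \<or> \<not> near 1 d \<and> \<not> near 1 e"
      using near_parent[of d] near_parent[of e] assms by blast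
    then show ?thesis using same[of 1] same[of 2] by auto
  qed
qed

lemma joined_root:
  assumes "w \<in> V" "w \<noteq> v" shows "joined w v"
proof (cases "lab w = 5")
  case True
  then obtain s where s: "s \<in> {1, 2}" "near s w"
    using near_parent[of w] assms by auto
  then obtain x where x: "lab x = s" "{w, x} \<in> E" "c {w, x} = 2 + s"
    using plain_edge[of w s] True assms by auto
  then show ?thesis
    using s root_edge[of x] edge_verts[OF x(2)] assms lab_v by (intro join[of "[w, x, v]"]) auto
next
  case False
  then have "{w, v} \<in> E" using root_edge[of w] labs[of w] lab0[of w] assms by auto
  then show ?thesis using assms by (intro join[of "[w, v]"]) auto
qed

lemma rainbow: "rainbow_connected V E c"
proof -
  have "joined u w" if "u \<in> V" "w \<in> V" "u \<noteq> w" for u w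
  proof (cases "{u, w} \<in> E")
    case True
    then show ?thesis using that by (intro join[of "[u, w]"]) auto
  next
    case False
    then have E: "{u, w} \<notin> E" "{w, u} \<notin> E" by (auto simp: insert_commute)
    have cases: "z = v \<or> lab z \<in> {1, 2} \<or> lab z = 5" if "z \<in> V" for z
      using labs[OF that] lab0[OF that] by auto
    show ?thesis
      using cases[of u] cases[of w] that E joined_root[of u] joined_root[of w] joined_outer[of u w]
        joined_inner[of u w] joined_inner_outer[of w u] joined_inner_outer[of u w]
        rainbow_joined_sym[of V E c w u]
      by auto
  qed
  then show ?thesis by (auto simp: rainbow_connected_def rainbow_joined_def)
qed

end

section \<open>Rainbow paths when the root is adjacent to every other vertex\<close>

text \<open>Different labels allow the path through \<open>v\<close>. For equal labels a first step
  along the rim to a vertex with another label gives colours \<open>5\<close>, \<open>lab y\<close>,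
  \<open>lab z\<close>; labels below 5 keep the rim colour apart.\<close>

lemma (in diameter_two) rainbow_star:
  assumes v: "v \<in> V" and star: "\<And>w. w \<in> V \<Longrightarrow> w \<noteq> v \<Longrightarrow> {v, w} \<in> E \<and> c {v, w} = lab w \<and> lab w < 5"
    and rim: "\<And>w z. \<lbrakk>{w, z} \<in> E; w \<noteq> v; z \<noteq> v\<rbrakk> \<Longrightarrow> c {w, z} = 5"
    and other: "\<And>w z. \<lbrakk>w \<in> V; z \<in> V; w \<noteq> v; z \<noteq> v; w \<noteq> z; {w, z} \<notin> E; lab w = lab z\<rbrakk> \<Longrightarrow>
        \<exists>y. y \<noteq> v \<and> {w, y} \<in> E \<and> lab y \<noteq> lab w"
  shows "rainbow_connected V E c"
proof -
  have "rainbow_joined V E c w z" if wz: "w \<in> V" "z \<in> V" "w \<noteq> z" for w z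
  proof (cases "{w, z} \<in> E")
    case True
    then show ?thesis using wz by (intro join[of "[w, z]"]) auto
  next
    case False
    then have nv: "w \<noteq> v" "z \<noteq> v" using star[of z] star[of w] wz edge_sym[of v w] by auto
    have wv: "{w, v} \<in> E" "c {w, v} = lab w"
      using star[of w] wz nv by (auto simp: insert_commute)
    show ?thesis
    proof (cases "lab w = lab z")
      case True
      then obtain y where y: "y \<noteq> v" "{w, y} \<in> E" "lab y \<noteq> lab w"
        using other wz nv False by blast
      have yV: "y \<in> V" "y \<noteq> w" using edge_verts[OF y(2)] by auto
      have yv: "{y, v} \<in> E" "c {y, v} = lab y"
        using star[of y] yV y by (auto simp: insert_commute)
      show ?thesis
        using y yV yv star[of z] star[of y] rim[of w y] wz nv True False
        by (intro join[of "[w, y, v, z]"]) auto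
    next
      case neq: False
      show ?thesis
        using star[of z] wv wz nv neq by (intro join[of "[w, v, z]"]) auto
    qed
  qed
  then show ?thesis by (auto simp: rainbow_connected_def rainbow_joined_def)
qed

section \<open>A language of polynomial-time array programs\<close>

datatype sexp =
    Num nat
  | Var nat
  | Cell nat sexp
  | Plus sexp sexp
  | Minus sexp sexp
  | Cond sexp sexp sexp
  | Sum nat sexp

datatype stmt =
    Assign nat sexp sexp
  | Then stmt stmt (infixr ";;" 60)
  | For nat stmt

type_synonym env = "nat \<Rightarrow> nat"

text \<open>Cell 0 of array 0 holds the number of vertices, which bounds every sum and every loop.\<close>

fun ev :: "sexp \<Rightarrow> memory \<Rightarrow> env \<Rightarrow> nat" where
  "ev (Num k) s \<sigma> = k"
| "ev (Var x) s \<sigma> = \<sigma> x"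
| "ev (Cell a e) s \<sigma> = s a (ev e s \<sigma>)"
| "ev (Plus d e) s \<sigma> = ev d s \<sigma> + ev e s \<sigma>"
| "ev (Minus d e) s \<sigma> = ev d s \<sigma> - ev e s \<sigma>"
| "ev (Cond b d e) s \<sigma> = (if ev b s \<sigma> \<noteq> 0 then ev d s \<sigma> else ev e s \<sigma>)"
| "ev (Sum x e) s \<sigma> = (\<Sum>i<s 0 0. ev e s (\<sigma>(x := i)))"

fun sem :: "stmt \<Rightarrow> memory \<Rightarrow> env \<Rightarrow> memory" where
  "sem (Assign a d e) s \<sigma> = put s a (ev d s \<sigma>) (ev e s \<sigma>)"
| "sem (p ;; q) s \<sigma> = sem q (sem p s \<sigma>) \<sigma>"
| "sem (For x p) s \<sigma> = fold (\<lambda>i s. sem p s (\<sigma>(x := i))) [0..<s 0 0] s"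

fun arrs :: "sexp \<Rightarrow> nat set" where
  "arrs (Num k) = {}"
| "arrs (Var x) = {}"
| "arrs (Cell a e) = insert a (arrs e)"
| "arrs (Plus d e) = arrs d \<union> arrs e"
| "arrs (Minus d e) = arrs d \<union> arrs e"
| "arrs (Cond b d e) = arrs b \<union> arrs d \<union> arrs e"
| "arrs (Sum x e) = arrs e"

fun reads :: "stmt \<Rightarrow> nat set" where
  "reads (Assign a d e) = arrs d \<union> arrs e"
| "reads (p ;; q) = reads p \<union> reads q"
| "reads (For x p) = reads p"

fun writes :: "stmt \<Rightarrow> nat set" where
  "writes (Assign a d e) = {a}"
| "writes (p ;; q) = writes p \<union> writes q"
| "writes (For x p) = writes p"

section \<open>Compilation to the random access machine, with time bounds\<close>

abbreviation reg :: "nat \<Rightarrow> exp" where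
  "reg r \<equiv> Get r (Const 0)"

text \<open>Truncated subtraction makes the guard nonzero exactly while the counter is below the
  bound. The bound is read again at every test, whereas \<open>sem\<close> reads it once; this is
  why compiled programs must not write to array 0.\<close>

definition repeat :: "nat \<Rightarrow> com \<Rightarrow> com" where
  "repeat x p = Seq (Put x (Const 0) (Const 0))
     (While (Sub (reg 0) (reg x)) (Seq p (Put x (Const 0) (Add (reg x) (Const 1)))))"

text \<open>Both compilers keep the values of the variables in the registers \<open>\<rho>\<close> and use only arrays
  from \<open>r\<close> on as scratch space; an expression leaves its value in register \<open>r\<close>.\<close>

fun compile :: "env \<Rightarrow> nat \<Rightarrow> sexp \<Rightarrow> com" where
  "compile \<rho> r (Num k) = Put r (Const 0) (Const k)"
| "compile \<rho> r (Var x) = Put r (Const 0) (reg (\<rho> x))"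
| "compile \<rho> r (Cell a e) = Seq (compile \<rho> r e) (Put r (Const 0) (Get a (reg r)))"
| "compile \<rho> r (Plus d e) = Seq (Seq (compile \<rho> r d) (compile \<rho> (Suc r) e))
     (Put r (Const 0) (Add (reg r) (reg (Suc r))))"
| "compile \<rho> r (Minus d e) = Seq (Seq (compile \<rho> r d) (compile \<rho> (Suc r) e))
     (Put r (Const 0) (Sub (reg r) (reg (Suc r))))"
| "compile \<rho> r (Cond b d e) = Seq (compile \<rho> r b) (If (reg r) (compile \<rho> r d) (compile \<rho> r e))"
| "compile \<rho> r (Sum x e) = Seq (Put r (Const 0) (Const 0)) (repeat (Suc r)
     (Seq (compile (\<rho>(x := Suc r)) (Suc (Suc r)) e)
       (Put r (Const 0) (Add (reg r) (reg (Suc (Suc r)))))))"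

fun compile_stmt :: "env \<Rightarrow> nat \<Rightarrow> stmt \<Rightarrow> com" where
  "compile_stmt \<rho> r (Assign a d e) = Seq (Seq (compile \<rho> r d) (compile \<rho> (Suc r) e))
     (Put a (reg r) (reg (Suc r)))"
| "compile_stmt \<rho> r (p ;; q) = Seq (compile_stmt \<rho> r p) (compile_stmt \<rho> r q)"
| "compile_stmt \<rho> r (For x p) = repeat r (compile_stmt (\<rho>(x := r)) (Suc r) p)"

text \<open>Each round pays 6 for the test and 6 for the increment; the constant 9 is 3 for the
  initialisation and 6 for the failing test. The indeterminate stands for the number of
  vertices.\<close>

definition loop_time :: "nat poly \<Rightarrow> nat poly" where
  "loop_time T = [:9:] + [:0, 1:] * (T + [:12:])"

fun exp_time :: "sexp \<Rightarrow> nat poly" where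
  "exp_time (Num k) = [:3:]"
| "exp_time (Var x) = [:4:]"
| "exp_time (Cell a e) = exp_time e + [:5:]"
| "exp_time (Plus d e) = exp_time d + exp_time e + [:7:]"
| "exp_time (Minus d e) = exp_time d + exp_time e + [:7:]"
| "exp_time (Cond b d e) = exp_time b + exp_time d + exp_time e + [:3:]"
| "exp_time (Sum x e) = [:3:] + loop_time (exp_time e + [:7:])"

fun stmt_time :: "stmt \<Rightarrow> nat poly" where
  "stmt_time (Assign a d e) = exp_time d + exp_time e + [:5:]"
| "stmt_time (p ;; q) = stmt_time p + stmt_time q"
| "stmt_time (For x p) = loop_time (stmt_time p)"

lemma put_same [simp]: "put s a i x a = (s a)(i := x)"
  and put_other [simp]: "a \<noteq> b \<Longrightarrow> put s a i x b = s b"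
  by (auto simp: put_def)

text \<open>Total correctness with a time bound. As execution is deterministic, one run describes
  all of them.\<close>

definition halts :: "com \<Rightarrow> memory \<Rightarrow> nat \<Rightarrow> (memory \<Rightarrow> bool) \<Rightarrow> bool" where
  "halts p s T Q \<longleftrightarrow> (\<exists>t s'. exec p s t s' \<and> t \<le> T \<and> Q s')"

lemma halts_mono: "halts p s T Q \<Longrightarrow> T \<le> T' \<Longrightarrow> (\<And>s'. Q s' \<Longrightarrow> Q' s') \<Longrightarrow> halts p s T' Q'"
  unfolding halts_def by (meson le_trans)

lemma halts_Put: "Q (put s a (val d s) (val e s)) \<Longrightarrow> 1 + cost d + cost e \<le> T \<Longrightarrow> halts (Put a d e) s T Q"
  unfolding halts_def using exec.Put by blast

lemma halts_Seq:
  assumes "halts p s T P" "\<And>s'. P s' \<Longrightarrow> halts q s' U Q" "T + U \<le> W"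
  shows "halts (Seq p q) s W Q"
  using assms unfolding halts_def by (meson exec.Seq add_mono le_trans)

text \<open>The bounds of both branches are added instead of taking their maximum, which keeps the
  bound a polynomial.\<close>

lemma halts_If:
  assumes "val b s \<noteq> 0 \<Longrightarrow> halts p s T Q" "val b s = 0 \<Longrightarrow> halts q s U Q" "1 + cost b + T + U \<le> W"
  shows "halts (If b p q) s W Q"
proof (cases "val b s = 0")
  case True
  then obtain t s' where "exec q s t s'" "t \<le> U" "Q s'" using assms(2) by (auto simp: halts_def)
  then show ?thesis
    using exec.IfFalse[OF True, of q t s' p] assms(3) unfolding halts_def by fastforce
next
  case False
  then obtain t s' where "exec p s t s'" "t \<le> T" "Q s'" using assms(1) by (auto simp: halts_def)
  then show ?thesis
    using exec.IfTrue[OF False, of p t s' q] assms(3) unfolding halts_def by fastforce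
qed

text \<open>The invariant is demanded after the counter has been increased, since the increment
  belongs to the compiled loop body and not to \<open>p\<close>.\<close>

lemma halts_repeat:
  assumes "I 0 (put s x 0 0)"
    and step: "\<And>i s. \<lbrakk>I i s; i < n; s x 0 = i\<rbrakk> \<Longrightarrow> halts p s T (\<lambda>s'. s' x 0 = i \<and> I (Suc i) (put s' x 0 (Suc i)))"
    and n: "\<And>i s. I i s \<Longrightarrow> s 0 0 = n"
    and W: "9 + n * (T + 12) \<le> W"
  shows "halts (repeat x p) s W (\<lambda>s'. I n s' )"
proof -
  define w where "w = While (Sub (reg 0) (reg x)) (Seq p (Put x (Const 0) (Add (reg x) (Const 1))))"
  \<comment> \<open>Induction on the number of rounds still to run; the 6 pays for the final
    test.\<close>
  have w: "halts w s (6 + (n - i) * (T + 12)) (\<lambda>s'. I n s')" if "I i s" "s x 0 = i" "i \<le> n" for i s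
    using that
  proof (induction "n - i" arbitrary: i s)
    case 0
    then have "i = n" by simp
    then have "exec w s (1 + cost (Sub (reg 0) (reg x))) s"
      unfolding w_def using 0 n[of i s] by (intro exec.WhileFalse) auto
    then show ?case unfolding halts_def using 0 \<open>i = n\<close>
      by (intro exI[of _ "1 + cost (Sub (reg 0) (reg x))"] exI[of _ s]) auto
  next
    case (Suc k)
    then have i: "i < n" by simp
    obtain t s' where s': "exec p s t s'" "t \<le> T" "s' x 0 = i" "I (Suc i) (put s' x 0 (Suc i))"
      using step[OF Suc.prems(1) i Suc.prems(2)] by (auto simp: halts_def)
    let ?s = "put s' x 0 (Suc i)"
    have "exec (Put x (Const 0) (Add (reg x) (Const 1))) s' 6 ?s"
      using exec.Put[of x "Const 0" "Add (reg x) (Const 1)" s'] s' by (simp add: eval_nat_numeral)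
    then have body: "exec (Seq p (Put x (Const 0) (Add (reg x) (Const 1)))) s (t + 6) ?s"
      using s' exec.Seq by blast
    have "halts w ?s (6 + (n - Suc i) * (T + 12)) (\<lambda>s'. I n s')"
      using Suc.hyps(1)[of "Suc i" ?s] Suc.hyps(2) s' i by simp
    then obtain u s'' where s'': "exec w ?s u s''" "u \<le> 6 + (n - Suc i) * (T + 12)" "I n s''"
      by (auto simp: halts_def)
    have "exec w s (1 + cost (Sub (reg 0) (reg x)) + (t + 6) + u) s''"
      unfolding w_def
      using Suc.prems n[of i s] i body s''(1) by (intro exec.WhileTrue) (auto simp: w_def)
    moreover have "n - i = Suc (n - Suc i)" using i by simp
    then have "1 + cost (Sub (reg 0) (reg x)) + (t + 6) + u \<le> 6 + (n - i) * (T + 12)"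
      using s' s'' by simp
    ultimately show ?case using s'' unfolding halts_def by blast
  qed
  show ?thesis
    unfolding repeat_def w_def[symmetric]
  proof (rule halts_Seq[where P="\<lambda>s'. I 0 s' \<and> s' x 0 = 0" and T=3 and U="6 + n * (T + 12)"])
    show "halts w s' (6 + n * (T + 12)) (\<lambda>s'. I n s')" if "I 0 s' \<and> s' x 0 = 0" for s'
      using w[of 0 s'] that by simp
  qed (use assms(1) W in \<open>auto intro!: halts_Put\<close>)
qed

lemma ev_cong:
  assumes "\<And>a. a \<in> arrs e \<Longrightarrow> s a = s' a" "s 0 0 = s' 0 0"
  shows "ev e s \<sigma> = ev e s' \<sigma>"
  using assms by (induction e arbitrary: \<sigma>) auto

text \<open>The frame condition on arrays below \<open>r\<close> is what makes nesting work: the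
  second operand is compiled from \<open>Suc r\<close> on and so preserves the first value, the
  variables and all arrays that are read.\<close>

lemma halts_compile:
  assumes "0 < r" "\<And>x. \<rho> x < r" "\<And>a. a \<in> arrs e \<Longrightarrow> a < r" "\<And>x. s (\<rho> x) 0 = \<sigma> x"
  shows "halts (compile \<rho> r e) s (poly (exp_time e) (s 0 0))
    (\<lambda>s'. s' r 0 = ev e s \<sigma> \<and> (\<forall>a<r. s' a = s a))"
  using assms
proof (induction e arbitrary: r \<rho> \<sigma> s)
  case (Num k)
  then show ?case by (auto intro!: halts_Put)
next
  case (Var x)
  then show ?case by (auto intro!: halts_Put)
next
  case (Cell a e)
  show ?case
    unfolding compile.simps
    by (rule halts_Seq[OF Cell.IH[of r \<rho> s \<sigma>]])
      (use Cell.prems in \<open>auto intro!: halts_Put[where T=5]\<close>)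
next
  case (Plus d e)
  have "halts (Seq (compile \<rho> r d) (compile \<rho> (Suc r) e)) s (poly (exp_time d) (s 0 0) + poly (exp_time e) (s 0 0))
    (\<lambda>s'. s' r 0 = ev d s \<sigma> \<and> s' (Suc r) 0 = ev e s \<sigma> \<and> (\<forall>a<r. s' a = s a))"
  proof (rule halts_Seq[OF Plus.IH(1)[of r \<rho> s \<sigma>]])
    fix s' assume s': "s' r 0 = ev d s \<sigma> \<and> (\<forall>a<r. s' a = s a)"
    have "ev e s' \<sigma> = ev e s \<sigma>" using s' Plus.prems by (intro ev_cong) auto
    then show "halts (compile \<rho> (Suc r) e) s' (poly (exp_time e) (s 0 0))
      (\<lambda>s'. s' r 0 = ev d s \<sigma> \<and> s' (Suc r) 0 = ev e s \<sigma> \<and> (\<forall>a<r. s' a = s a))"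
      using s' Plus.prems by (intro halts_mono[OF Plus.IH(2)[of "Suc r" \<rho> s' \<sigma>]]) (auto simp: less_Suc_eq)
  qed (use Plus.prems in auto)
  then show ?case
    unfolding compile.simps
    by (rule halts_Seq[where U=7]) (auto intro!: halts_Put)
next
  case (Minus d e)
  have "halts (Seq (compile \<rho> r d) (compile \<rho> (Suc r) e)) s (poly (exp_time d) (s 0 0) + poly (exp_time e) (s 0 0))
    (\<lambda>s'. s' r 0 = ev d s \<sigma> \<and> s' (Suc r) 0 = ev e s \<sigma> \<and> (\<forall>a<r. s' a = s a))"
  proof (rule halts_Seq[OF Minus.IH(1)[of r \<rho> s \<sigma>]])
    fix s' assume s': "s' r 0 = ev d s \<sigma> \<and> (\<forall>a<r. s' a = s a)"
    have "ev e s' \<sigma> = ev e s \<sigma>" using s' Minus.prems by (intro ev_cong) auto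
    then show "halts (compile \<rho> (Suc r) e) s' (poly (exp_time e) (s 0 0))
      (\<lambda>s'. s' r 0 = ev d s \<sigma> \<and> s' (Suc r) 0 = ev e s \<sigma> \<and> (\<forall>a<r. s' a = s a))"
      using s' Minus.prems by (intro halts_mono[OF Minus.IH(2)[of "Suc r" \<rho> s' \<sigma>]]) (auto simp: less_Suc_eq)
  qed (use Minus.prems in auto)
  then show ?case
    unfolding compile.simps
    by (rule halts_Seq[where U=7]) (auto intro!: halts_Put)
next
  case (Cond b d e)
  show ?case
    unfolding compile.simps
  proof (rule halts_Seq[OF Cond.IH(1)[of r \<rho> s \<sigma>]])
    fix s' assume s': "s' r 0 = ev b s \<sigma> \<and> (\<forall>a<r. s' a = s a)"
    have eq: "ev d s' \<sigma> = ev d s \<sigma>" "ev e s' \<sigma> = ev e s \<sigma>"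
      using s' Cond.prems by (auto intro!: ev_cong)
    show "halts (If (reg r) (compile \<rho> r d) (compile \<rho> r e)) s' (poly (exp_time d + exp_time e + [:3:]) (s 0 0))
      (\<lambda>s'. s' r 0 = ev (Cond b d e) s \<sigma> \<and> (\<forall>a<r. s' a = s a))"
      by (rule halts_If[where T="poly (exp_time d) (s 0 0)" and U="poly (exp_time e) (s 0 0)"])
        (use s' Cond.prems eq in \<open>auto intro!: halts_mono[OF Cond.IH(2)[of r \<rho> s' \<sigma>]] 
          halts_mono[OF Cond.IH(3)[of r \<rho> s' \<sigma>]]\<close>)
  qed (use Cond.prems in auto)
next
  case (Sum x e)
  let ?n = "s 0 0"
  \<comment> \<open>Register \<open>r\<close> accumulates the partial sum, \<open>Suc r\<close>
    counts and \<open>Suc (Suc r)\<close> receives the summand. The summands refer to the initial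
    memory, which agrees with the current one on every array that \<open>e\<close> reads.\<close>
  let ?I = "\<lambda>i s'. s' r 0 = (\<Sum>j<i. ev e s (\<sigma>(x := j))) \<and> (\<forall>a<r. s' a = s a)"
  have body: "halts (Seq (compile (\<rho>(x := Suc r)) (Suc (Suc r)) e)
      (Put r (Const 0) (Add (reg r) (reg (Suc (Suc r)))))) s1 (poly (exp_time e) ?n + 7)
      (\<lambda>s'. s' (Suc r) 0 = i \<and> ?I (Suc i) (put s' (Suc r) 0 (Suc i)))"
    if I: "?I i s1" "s1 (Suc r) 0 = i" for i s1
  proof (rule halts_Seq[OF Sum.IH[of "Suc (Suc r)" "\<rho>(x := Suc r)" s1 "\<sigma>(x := i)"]])
    fix s' assume s': "s' (Suc (Suc r)) 0 = ev e s1 (\<sigma>(x := i)) \<and> (\<forall>a<Suc (Suc r). s' a = s1 a)"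
    have "ev e s1 (\<sigma>(x := i)) = ev e s (\<sigma>(x := i))"
      using I Sum.prems by (intro ev_cong) auto
    then show "halts (Put r (Const 0) (Add (reg r) (reg (Suc (Suc r))))) s' 7
      (\<lambda>s'. s' (Suc r) 0 = i \<and> ?I (Suc i) (put s' (Suc r) 0 (Suc i)))"
      using s' I by (intro halts_Put) (auto simp: put_def less_Suc_eq)
  qed (use Sum.prems I in \<open>auto simp: less_Suc_eq\<close>)
  show ?case
    unfolding compile.simps
  proof (rule halts_Seq[where T=3 and U="poly (loop_time (exp_time e + [:7:])) ?n" and P="?I 0"])
    fix s1 assume "?I 0 s1"
    then have "halts (repeat (Suc r) (Seq (compile (\<rho>(x := Suc r)) (Suc (Suc r)) e)
        (Put r (Const 0) (Add (reg r) (reg (Suc (Suc r))))))) s1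
        (poly (loop_time (exp_time e + [:7:])) ?n) (?I ?n)"
      using Sum.prems(1)
      by (intro halts_repeat[where I="?I" and n="?n" and T="poly (exp_time e) ?n + 7", OF _ body])
        (auto simp: loop_time_def algebra_simps)
    then show "halts (repeat (Suc r) (Seq (compile (\<rho>(x := Suc r)) (Suc (Suc r)) e)
        (Put r (Const 0) (Add (reg r) (reg (Suc (Suc r))))))) s1
        (poly (loop_time (exp_time e + [:7:])) ?n) (\<lambda>s'. s' r 0 = ev (Sum x e) s \<sigma> \<and> (\<forall>a<r. s' a = s a))"
      by simp
  qed (auto intro!: halts_Put)
qed

lemma sem_other: "a \<notin> writes p \<Longrightarrow> sem p s \<sigma> a = s a"
proof (induction p arbitrary: s \<sigma>)
  case (For x p)
  have "fold (\<lambda>i s. sem p s (\<sigma>(x := i))) xs s a = s a" for xs s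
    using For by (induction xs arbitrary: s) auto
  then show ?case by simp
qed auto

text \<open>Compiled and source memories agree only below the scratch space, so the source semantics
  must not depend on anything beyond it.\<close>

lemma sem_cong:
  assumes "\<And>a. a < r \<Longrightarrow> s a = s' a" "0 < r" "\<And>a. a \<in> reads p \<Longrightarrow> a < r" "a < r"
  shows "sem p s \<sigma> a = sem p s' \<sigma> a"
  using assms
proof (induction p arbitrary: s s' \<sigma> a)
  case (Assign b d e)
  then have "ev d s \<sigma> = ev d s' \<sigma>" "ev e s \<sigma> = ev e s' \<sigma>" by (auto intro!: ev_cong)
  then show ?case using Assign by (auto simp: put_def)
next
  case (Then p q)
  have "sem q (sem p s \<sigma>) \<sigma> a = sem q (sem p s' \<sigma>) \<sigma> a"
    using Then.prems by (intro Then.IH(2) Then.IH(1)) auto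
  then show ?case by simp
next
  case (For x p)
  have "fold (\<lambda>i s. sem p s (\<sigma>(x := i))) xs s a = fold (\<lambda>i s. sem p s (\<sigma>(x := i))) xs s' a"
    if "\<And>a. a < r \<Longrightarrow> s a = s' a" "a < r" for xs s s' a
    using that
  proof (induction xs arbitrary: s s' a)
    case (Cons i xs)
    have "sem p s (\<sigma>(x := i)) b = sem p s' (\<sigma>(x := i)) b" if "b < r" for b
      using Cons.prems For.prems that by (intro For.IH) auto
    then show ?case
      using Cons.IH[of "sem p s (\<sigma>(x := i))" "sem p s' (\<sigma>(x := i))"] Cons.prems(2)
      by (simp add: fun_upd_def)
  qed auto
  from this[OF For.prems(1) For.prems(4)] show ?case using For.prems(1,2) by (simp add: fun_upd_def)
qed

lemma halts_compile_stmt: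
  assumes "0 < r" "\<And>x. \<rho> x < r" "\<And>a. a \<in> reads p \<union> writes p \<Longrightarrow> a < r" "\<And>x. \<rho> x \<notin> writes p"
    "0 \<notin> writes p" "\<And>x. s (\<rho> x) 0 = \<sigma> x"
  shows "halts (compile_stmt \<rho> r p) s (poly (stmt_time p) (s 0 0)) (\<lambda>s'. \<forall>a<r. s' a = sem p s \<sigma> a)"
  using assms
proof (induction p arbitrary: r \<rho> \<sigma> s)
  case (Assign b d e)
  have "halts (Seq (compile \<rho> r d) (compile \<rho> (Suc r) e)) s (poly (exp_time d) (s 0 0) + poly (exp_time e) (s 0 0))
    (\<lambda>s'. s' r 0 = ev d s \<sigma> \<and> s' (Suc r) 0 = ev e s \<sigma> \<and> (\<forall>a<r. s' a = s a))"
  proof (rule halts_Seq[OF halts_compile[of r \<rho> d s \<sigma>]])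
    fix s' assume s': "s' r 0 = ev d s \<sigma> \<and> (\<forall>a<r. s' a = s a)"
    have "ev e s' \<sigma> = ev e s \<sigma>" using s' Assign.prems by (intro ev_cong) auto
    then show "halts (compile \<rho> (Suc r) e) s' (poly (exp_time e) (s 0 0))
      (\<lambda>s'. s' r 0 = ev d s \<sigma> \<and> s' (Suc r) 0 = ev e s \<sigma> \<and> (\<forall>a<r. s' a = s a))"
      using s' Assign.prems
      by (intro halts_mono[OF halts_compile[of "Suc r" \<rho> e s' \<sigma>]]) (auto simp: less_Suc_eq)
  qed (use Assign.prems in auto)
  then show ?case
    unfolding compile_stmt.simps
    by (rule halts_Seq[where U=5]) (auto intro!: halts_Put simp: put_def)
next
  case (Then p q)
  show ?case
    unfolding compile_stmt.simps
  proof (rule halts_Seq[OF Then.IH(1)[of r \<rho> s \<sigma>]])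
    fix s' assume s': "\<forall>a<r. s' a = sem p s \<sigma> a"
    have [simp]: "s' 0 0 = s 0 0" using s' Then.prems sem_other[of 0 p s \<sigma>] by auto
    have "s' (\<rho> x) = s (\<rho> x)" for x using s' Then.prems sem_other[of "\<rho> x" p s \<sigma>] by auto
    moreover have "sem q s' \<sigma> a = sem q (sem p s \<sigma>) \<sigma> a" if "a < r" for a
      using s' Then.prems that by (intro sem_cong[of r]) auto
    ultimately show "halts (compile_stmt \<rho> r q) s' (poly (stmt_time q) (s 0 0))
      (\<lambda>s'. \<forall>a<r. s' a = sem (p ;; q) s \<sigma> a)"
      using Then.prems by (intro halts_mono[OF Then.IH(2)[of r \<rho> s' \<sigma>]]) auto
  qed (use Then.prems in auto)
next
  case (For x p)
  let ?n = "s 0 0"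
  \<comment> \<open>The source memory after \<open>i\<close> rounds; the compiled loop matches it on
    arrays below \<open>r\<close>, and its counter in array \<open>r\<close> is out of reach of the
    body.\<close>
  define F where "F i = fold (\<lambda>i s. sem p s (\<sigma>(x := i))) [0..<i] s" for i
  have F_other: "F i a = s a" if "a \<notin> writes p" for i a
    using that by (induction i) (auto simp: F_def sem_other)
  let ?I = "\<lambda>i s'. \<forall>a<r. s' a = F i a"
  have body: "halts (compile_stmt (\<rho>(x := r)) (Suc r) p) s1 (poly (stmt_time p) ?n)
      (\<lambda>s'. s' r 0 = i \<and> ?I (Suc i) (put s' r 0 (Suc i)))"
    if I: "?I i s1" "s1 r 0 = i" for i s1
  proof -
    have r: "r \<notin> writes p" using For.prems by force
    have "halts (compile_stmt (\<rho>(x := r)) (Suc r) p) s1 (poly (stmt_time p) (s1 0 0))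
      (\<lambda>s'. \<forall>a<Suc r. s' a = sem p s1 (\<sigma>(x := i)) a)"
    proof (rule For.IH)
      show "s1 ((\<rho>(x := r)) y) 0 = (\<sigma>(x := i)) y" for y
        using I For.prems F_other[of "\<rho> y" i] by simp
      show "(\<rho>(x := r)) y \<notin> writes p" "(\<rho>(x := r)) y < Suc r" for y
        using For.prems(2,4) r by (auto simp: less_Suc_eq)
      show "a < Suc r" if "a \<in> reads p \<union> writes p" for a
        using For.prems(3)[of a] that by (simp add: less_Suc_eq)
    qed (use For.prems in auto)
    moreover have "s1 0 0 = ?n" using I For.prems F_other[of 0 i] by simp
    moreover have "s' r 0 = i \<and> ?I (Suc i) (put s' r 0 (Suc i))"
      if s': "\<forall>a<Suc r. s' a = sem p s1 (\<sigma>(x := i)) a" for s'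
    proof -
      have "sem p s1 (\<sigma>(x := i)) a = sem p (F i) (\<sigma>(x := i)) a" if "a < r" for a
        using I For.prems that by (intro sem_cong[of r]) auto
      moreover have "F (Suc i) = sem p (F i) (\<sigma>(x := i))" by (simp add: F_def)
      ultimately show ?thesis
        using s' r sem_other[of r p s1] I by simp
    qed
    ultimately show ?thesis by (auto elim!: halts_mono)
  qed
  have "halts (compile_stmt \<rho> r (For x p)) s (poly (stmt_time (For x p)) ?n) (?I ?n)"
    unfolding compile_stmt.simps
    using For.prems F_other[of 0]
    by (intro halts_repeat[where I="?I" and n="?n" and T="poly (stmt_time p) ?n", OF _ body])
      (auto simp: loop_time_def F_def)
  then show ?case by (simp add: F_def)
qed

section \<open>Predicates as expressions, and rules for the loop patterns used\<close>

text \<open>Truth means nonzero rather than 1, so that addition acts as disjunction and a bounded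
  sum as an existential quantifier.\<close>

definition holds :: "sexp \<Rightarrow> memory \<Rightarrow> env \<Rightarrow> bool" where
  "holds e s \<sigma> \<longleftrightarrow> ev e s \<sigma> \<noteq> 0"

definition Neg :: "sexp \<Rightarrow> sexp" where "Neg e = Minus (Num 1) e"
definition And :: "sexp \<Rightarrow> sexp \<Rightarrow> sexp" where "And d e = Cond d e (Num 0)"
definition Less :: "sexp \<Rightarrow> sexp \<Rightarrow> sexp" where "Less d e = Minus e d"
definition Eq :: "sexp \<Rightarrow> sexp \<Rightarrow> sexp" where "Eq d e = Neg (Plus (Minus d e) (Minus e d))"

lemmas macros = Neg_def And_def Less_def Eq_def

lemma holds_simps [simp]:
  "holds (Neg e) s \<sigma> \<longleftrightarrow> \<not> holds e s \<sigma>"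
  "holds (And d e) s \<sigma> \<longleftrightarrow> holds d s \<sigma> \<and> holds e s \<sigma>"
  "holds (Less d e) s \<sigma> \<longleftrightarrow> ev d s \<sigma> < ev e s \<sigma>"
  "holds (Eq d e) s \<sigma> \<longleftrightarrow> ev d s \<sigma> = ev e s \<sigma>"
  "holds (Plus d e) s \<sigma> \<longleftrightarrow> holds d s \<sigma> \<or> holds e s \<sigma>"
  "holds (Sum x e) s \<sigma> \<longleftrightarrow> (\<exists>i<s 0 0. holds e s (\<sigma>(x := i)))"
  by (auto simp: holds_def macros)

lemma holds_Cell: "holds (Cell a e) s \<sigma> \<longleftrightarrow> s a (ev e s \<sigma>) \<noteq> 0"
  by (simp add: holds_def)

lemma ev_Cond [simp]: "ev (Cond b d e) s \<sigma> = (if holds b s \<sigma> then ev d s \<sigma> else ev e s \<sigma>)"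
  by (simp add: holds_def)

lemmas [simp del] = ev.simps(6)

lemma holds_cong:
  assumes "\<And>a. a \<in> arrs e \<Longrightarrow> s a = s' a" "s 0 0 = s' 0 0"
  shows "holds e s \<sigma> = holds e s' \<sigma>"
  unfolding holds_def using assms by (subst ev_cong[of e s s']) auto

lemma sem_For_inv:
  assumes "J 0 s" "\<And>i t. i < s 0 0 \<Longrightarrow> J i t \<Longrightarrow> J (Suc i) (sem p t (\<sigma>(x := i)))"
  shows "J (s 0 0) (sem (For x p) s \<sigma>)"
proof -
  have "J k (fold (\<lambda>i s. sem p s (\<sigma>(x := i))) [0..<k] s)" if "k \<le> s 0 0" for k
    using that by (induction k) (auto intro: assms)
  then show ?thesis by simp
qed

text \<open>As \<open>e\<close> does not read the array being filled, all assignments see the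
  initial contents.\<close>

lemma sem_map:
  assumes "a \<notin> arrs e" "a \<noteq> 0"
  shows "sem (For x (Assign a (Var x) e)) s \<sigma> =
    s(a := (\<lambda>i. if i < s 0 0 then ev e s (\<sigma>(x := i)) else s a i))"
proof (rule sem_For_inv[where J="\<lambda>k t. t = s(a := (\<lambda>i. if i < k then ev e s (\<sigma>(x := i)) else s a i))"])
  fix k t assume t: "t = s(a := (\<lambda>i. if i < k then ev e s (\<sigma>(x := i)) else s a i))"
  have eq: "ev e (s(a := g)) \<tau> = ev e s \<tau>" for g \<tau>
    using assms by (intro ev_cong) auto
  show "sem (Assign a (Var x) e) t (\<sigma>(x := k)) =
      s(a := (\<lambda>i. if i < Suc k then ev e s (\<sigma>(x := i)) else s a i))"
    unfolding t by (auto simp: eq put_def less_Suc_eq fun_eq_iff)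
qed auto

text \<open>Linear search: each hit overwrites the cell and each miss rewrites its own value. The
  index \<open>d\<close> must denote the fixed cell \<open>k\<close> whatever array \<open>a\<close>
  contains.\<close>

lemma sem_pick:
  assumes "a \<notin> arrs b" "a \<notin> arrs f" "a \<noteq> 0" and idx: "\<And>g i. ev d (s(a := g)) (\<sigma>(x := i)) = k"
  shows "\<exists>y. sem (For x (Assign a d (Cond b f (Cell a d)))) s \<sigma> = s(a := (s a)(k := y)) \<and>
    ((\<exists>i<s 0 0. holds b s (\<sigma>(x := i)) \<and> y = ev f s (\<sigma>(x := i))) \<or>
     (\<forall>i<s 0 0. \<not> holds b s (\<sigma>(x := i))) \<and> y = s a k)"
proof (rule sem_For_inv[where J="\<lambda>m t. \<exists>y. t = s(a := (s a)(k := y)) \<and>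
    ((\<exists>i<m. holds b s (\<sigma>(x := i)) \<and> y = ev f s (\<sigma>(x := i))) \<or>
     (\<forall>i<m. \<not> holds b s (\<sigma>(x := i))) \<and> y = s a k)"])
  show "\<exists>y. s = s(a := (s a)(k := y)) \<and>
    ((\<exists>i<0. holds b s (\<sigma>(x := i)) \<and> y = ev f s (\<sigma>(x := i))) \<or>
     (\<forall>i<0. \<not> holds b s (\<sigma>(x := i))) \<and> y = s a k)"
    by (intro exI[of _ "s a k"]) auto
next
  fix m t assume "\<exists>y. t = s(a := (s a)(k := y)) \<and>
    ((\<exists>i<m. holds b s (\<sigma>(x := i)) \<and> y = ev f s (\<sigma>(x := i))) \<or>
     (\<forall>i<m. \<not> holds b s (\<sigma>(x := i))) \<and> y = s a k)"
  then obtain y where t: "t = s(a := (s a)(k := y))"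
    and y: "(\<exists>i<m. holds b s (\<sigma>(x := i)) \<and> y = ev f s (\<sigma>(x := i))) \<or>
     (\<forall>i<m. \<not> holds b s (\<sigma>(x := i))) \<and> y = s a k" by blast
  have eq: "ev f (s(a := g)) \<tau> = ev f s \<tau>" "holds b (s(a := g)) \<tau> = holds b s \<tau>" for g \<tau>
    using assms by (auto intro!: ev_cong holds_cong)
  let ?y = "if holds b s (\<sigma>(x := m)) then ev f s (\<sigma>(x := m)) else y"
  have "sem (Assign a d (Cond b f (Cell a d))) t (\<sigma>(x := m)) = s(a := (s a)(k := ?y))"
    by (simp add: t eq idx put_def)
  then show "\<exists>y. sem (Assign a d (Cond b f (Cell a d))) t (\<sigma>(x := m)) = s(a := (s a)(k := y)) \<and>
    ((\<exists>i<Suc m. holds b s (\<sigma>(x := i)) \<and> y = ev f s (\<sigma>(x := i))) \<or>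
     (\<forall>i<Suc m. \<not> holds b s (\<sigma>(x := i))) \<and> y = s a k)"
    using y by (intro exI[of _ ?y]) (auto simp: less_Suc_eq)
qed

text \<open>One search per row \<open>i\<close>, with its result in cell \<open>i\<close>.\<close>

lemma sem_pick2:
  assumes "a \<notin> arrs b" "a \<notin> arrs f" "a \<noteq> 0" "x \<noteq> y"
  defines "Q \<equiv> \<lambda>s \<sigma> m i. (\<exists>j<s 0 0. holds b s (\<sigma>(x := i, y := j)) \<and> m i = ev f s (\<sigma>(x := i, y := j))) \<or>
     (\<forall>j<s 0 0. \<not> holds b s (\<sigma>(x := i, y := j))) \<and> m i = s a i"
  shows "\<exists>m. sem (For x (For y (Assign a (Var x) (Cond b f (Cell a (Var x)))))) s \<sigma> = s(a := m) \<and>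
    (\<forall>i<s 0 0. Q s \<sigma> m i)"
proof -
  let ?p = "For y (Assign a (Var x) (Cond b f (Cell a (Var x))))"
  have "\<exists>m. sem (For x ?p) s \<sigma> = s(a := m) \<and> (\<forall>i<s 0 0. Q s \<sigma> m i) \<and> (\<forall>i\<ge>s 0 0. m i = s a i)"
  proof (rule sem_For_inv[where J="\<lambda>k t. \<exists>m. t = s(a := m) \<and> (\<forall>i<k. Q s \<sigma> m i) \<and> (\<forall>i\<ge>k. m i = s a i)"])
    fix k t assume "\<exists>m. t = s(a := m) \<and> (\<forall>i<k. Q s \<sigma> m i) \<and> (\<forall>i\<ge>k. m i = s a i)"
    then obtain m where m: "t = s(a := m)" "\<forall>i<k. Q s \<sigma> m i" "\<forall>i\<ge>k. m i = s a i" by blast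
    have eq: "ev f (s(a := g)) \<tau> = ev f s \<tau>" "holds b (s(a := g)) \<tau> = holds b s \<tau>" for g \<tau>
      using assms(1-3) by (auto intro!: ev_cong holds_cong)
    have "ev (Var x) (t(a := g)) ((\<sigma>(x := k))(y := j)) = k" for g j
      using assms(4) by simp
    from sem_pick[where s=t and \<sigma>="\<sigma>(x := k)" and d="Var x" and k=k and x=y, OF assms(1-3) this]
    obtain z where z: "sem ?p t (\<sigma>(x := k)) = t(a := (t a)(k := z))"
      "(\<exists>j<s 0 0. holds b s (\<sigma>(x := k, y := j)) \<and> z = ev f s (\<sigma>(x := k, y := j))) \<or>
       (\<forall>j<s 0 0. \<not> holds b s (\<sigma>(x := k, y := j))) \<and> z = m k"
      using assms(3) by (auto simp: m(1) eq)
    have "sem ?p t (\<sigma>(x := k)) = s(a := m(k := z))"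
      unfolding z(1) by (simp add: m(1))
    moreover have "\<forall>i<Suc k. Q s \<sigma> (m(k := z)) i"
      using z(2) m(2,3) by (auto simp: less_Suc_eq Q_def)
    ultimately show "\<exists>m. sem ?p t (\<sigma>(x := k)) = s(a := m) \<and> (\<forall>i<Suc k. Q s \<sigma> m i) \<and> (\<forall>i\<ge>Suc k. m i = s a i)"
      using m(3) by (intro exI[of _ "m(k := z)"]) auto
  qed (auto intro: exI[of _ "s a"])
  then show ?thesis by blast
qed

lemma sem_greedy:
  fixes s :: memory and \<sigma> :: env
  assumes "a \<notin> arrs b" "a \<notin> arrs r" "a \<noteq> 0" "x \<noteq> y"
  defines "P \<equiv> \<lambda>i. holds b s (\<sigma>(x := i))" and "R \<equiv> \<lambda>i j. holds r s (\<sigma>(x := i, y := j))"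
  assumes sym: "\<And>i j. \<lbrakk>i < s 0 0; j < s 0 0; R i j\<rbrakk> \<Longrightarrow> R j i"
    and init: "\<And>i j. \<lbrakk>i < s 0 0; j < s 0 0; i \<noteq> j; s a i \<noteq> 0; s a j \<noteq> 0\<rbrakk> \<Longrightarrow> \<not> R i j"
  shows "\<exists>g. sem (For x (Assign a (Var x)
        (Cond (And b (Neg (Sum y (And (Cell a (Var y)) r)))) (Num 1) (Cell a (Var x))))) s \<sigma> = s(a := g) \<and>
      (\<forall>i<s 0 0. (s a i \<noteq> 0 \<longrightarrow> g i \<noteq> 0) \<and> (g i \<noteq> 0 \<longrightarrow> s a i \<noteq> 0 \<or> P i) \<and>
        (P i \<longrightarrow> g i \<noteq> 0 \<or> (\<exists>j<s 0 0. g j \<noteq> 0 \<and> R i j)) \<and>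
        (\<forall>j<s 0 0. i \<noteq> j \<and> g i \<noteq> 0 \<and> g j \<noteq> 0 \<longrightarrow> \<not> R i j))"
proof -
  let ?p = "Assign a (Var x) (Cond (And b (Neg (Sum y (And (Cell a (Var y)) r)))) (Num 1) (Cell a (Var x)))"
  let ?Q = "\<lambda>k g. \<forall>i<s 0 0. (s a i \<noteq> 0 \<longrightarrow> g i \<noteq> 0) \<and> (g i \<noteq> 0 \<longrightarrow> s a i \<noteq> 0 \<or> P i) \<and>
        (P i \<and> i < k \<longrightarrow> g i \<noteq> 0 \<or> (\<exists>j<s 0 0. g j \<noteq> 0 \<and> R i j)) \<and>
        (\<forall>j<s 0 0. i \<noteq> j \<and> g i \<noteq> 0 \<and> g j \<noteq> 0 \<longrightarrow> \<not> R i j)"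
  have eq: "holds b (s(a := g)) \<tau> = holds b s \<tau>" "holds r (s(a := g)) \<tau> = holds r s \<tau>" for g \<tau>
    using assms(1-3) by (auto intro!: holds_cong)
  have "\<exists>g. sem (For x ?p) s \<sigma> = s(a := g) \<and> ?Q (s 0 0) g"
  proof (rule sem_For_inv[where J="\<lambda>k t. \<exists>g. t = s(a := g) \<and> ?Q k g"])
    show "\<exists>g. s = s(a := g) \<and> ?Q 0 g"
      using init by (intro exI[of _ "s a"]) auto
  next
    fix k t assume k: "k < s 0 0" and "\<exists>g. t = s(a := g) \<and> ?Q k g"
    then obtain g where t: "t = s(a := g)" and inv: "?Q k g" by blast
    let ?add = "P k \<and> \<not> (\<exists>j<s 0 0. g j \<noteq> 0 \<and> R k j)"
    have step: "sem ?p t (\<sigma>(x := k)) = s(a := g(k := if ?add then 1 else g k))"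
      using assms(3,4) by (auto simp: t eq put_def holds_Cell P_def R_def)
    show "\<exists>g. sem ?p t (\<sigma>(x := k)) = s(a := g) \<and> ?Q (Suc k) g"
    \<comment> \<open>The test excludes conflicts of \<open>k\<close> with the members; symmetry of
      \<open>R\<close> excludes conflicts of the members with \<open>k\<close>.\<close>
    proof (cases ?add)
      case True
      have "\<not> R j k" if "j < s 0 0" "g j \<noteq> 0" for j
        using True sym[of j k] that k by auto
      moreover have "(g(k := 1)) i \<noteq> 0 \<or> (\<exists>j<s 0 0. (g(k := 1)) j \<noteq> 0 \<and> R i j)"
        if "i < s 0 0" "P i" "i < Suc k" for i
      proof (cases "i = k")
        case False
        then have "g i \<noteq> 0 \<or> (\<exists>j<s 0 0. g j \<noteq> 0 \<and> R i j)" using inv that by auto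
        then show ?thesis by (metis fun_upd_apply one_neq_zero)
      qed auto
      ultimately have "?Q (Suc k) (g(k := 1))"
        using True inv k by auto
      then show ?thesis
        unfolding step using True by (intro exI[of _ "g(k := 1)"]) simp
    next
      case False
      then show ?thesis
        unfolding step using inv k by (intro exI[of _ g]) (auto simp: less_Suc_eq)
    qed
  qed
  then show ?thesis by auto
qed

lemma row_index_inj:
  fixes n :: nat
  assumes "n * u + w = n * u' + w'" "w < n" "w' < n" shows "u = u' \<and> w = w'"
proof -
  have "(n * u + w) div n = u" "(n * u' + w') div n = u'" using assms(2,3) by simp_all
  then show ?thesis using assms by auto
qed

text \<open>The sum over \<open>z\<close> evaluates to \<open>n * x\<close>, the row offset.
  Distinct rows occupy disjoint index ranges, so later rows leave earlier ones intact.\<close>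

lemma sem_matrix:
  assumes "a \<notin> arrs e" "a \<noteq> 0" "x \<noteq> y" "z \<noteq> x" "z \<noteq> y"
  shows "\<exists>h. sem (For x (For y (Assign a (Plus (Sum z (Var x)) (Var y)) e))) s \<sigma> = s(a := h) \<and>
    (\<forall>u<s 0 0. \<forall>w<s 0 0. h (s 0 0 * u + w) = ev e s (\<sigma>(x := u, y := w)))"
proof -
  let ?n = "s 0 0"
  let ?q = "Assign a (Plus (Sum z (Var x)) (Var y)) e"
  have eq: "ev e (s(a := g)) \<tau> = ev e s \<tau>" for g \<tau>
    using assms by (auto intro!: ev_cong)
  have row: "\<exists>h. sem (For y ?q) (s(a := g)) (\<sigma>(x := u)) = s(a := h) \<and>
    (\<forall>j<?n. h (?n * u + j) = ev e s (\<sigma>(x := u, y := j))) \<and>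
    (\<forall>m. (\<forall>j<?n. m \<noteq> ?n * u + j) \<longrightarrow> h m = g m)" for u g
  proof -
    let ?J = "\<lambda>k t. \<exists>h. t = s(a := h) \<and>
      (\<forall>j<k. h (?n * u + j) = ev e s (\<sigma>(x := u, y := j))) \<and>
      (\<forall>m. (\<forall>j<k. m \<noteq> ?n * u + j) \<longrightarrow> h m = g m)"
    have "?J ((s(a := g)) 0 0) (sem (For y ?q) (s(a := g)) (\<sigma>(x := u)))"
    proof (rule sem_For_inv[where J="?J"])
      show "?J 0 (s(a := g))" by (intro exI[of _ g]) auto
      fix k t assume "?J k t"
      then obtain h where h: "t = s(a := h)"
        "\<forall>j<k. h (?n * u + j) = ev e s (\<sigma>(x := u, y := j))"
        "\<forall>m. (\<forall>j<k. m \<noteq> ?n * u + j) \<longrightarrow> h m = g m" by blast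
      let ?h = "h(?n * u + k := ev e s (\<sigma>(x := u, y := k)))"
      have "sem ?q t (\<sigma>(x := u, y := k)) = s(a := ?h)"
        using assms by (simp add: h(1) eq put_def)
      then show "?J (Suc k) (sem ?q t (\<sigma>(x := u, y := k)))"
        using h(2,3) by (intro exI[of _ ?h]) (auto simp: less_Suc_eq)
    qed
    then show ?thesis using assms(2) by simp
  qed
  show ?thesis
  proof (rule sem_For_inv[where J="\<lambda>k t. \<exists>h. t = s(a := h) \<and>
      (\<forall>u<k. \<forall>w<?n. h (?n * u + w) = ev e s (\<sigma>(x := u, y := w)))"])
    fix k t assume "\<exists>h. t = s(a := h) \<and> (\<forall>u<k. \<forall>w<?n. h (?n * u + w) = ev e s (\<sigma>(x := u, y := w)))"
    then obtain g where g: "t = s(a := g)"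
      "\<forall>u<k. \<forall>w<?n. g (?n * u + w) = ev e s (\<sigma>(x := u, y := w))" by blast
    obtain h where h: "sem (For y ?q) (s(a := g)) (\<sigma>(x := k)) = s(a := h)"
      "\<forall>j<?n. h (?n * k + j) = ev e s (\<sigma>(x := k, y := j))"
      "\<forall>m. (\<forall>j<?n. m \<noteq> ?n * k + j) \<longrightarrow> h m = g m" using row by blast
    have "h (?n * u + w) = ev e s (\<sigma>(x := u, y := w))" if "u < Suc k" "w < ?n" for u w
    proof (cases "u = k")
      case False
      then have "h (?n * u + w) = g (?n * u + w)"
        using h(3) row_index_inj[of ?n u w k] that by blast
      then show ?thesis using g(2) that False by simp
    qed (use h(2) that in auto)
    then show "\<exists>h. sem (For y ?q) t (\<sigma>(x := k)) = s(a := h) \<and>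
      (\<forall>u<Suc k. \<forall>w<?n. h (?n * u + w) = ev e s (\<sigma>(x := u, y := w)))"
      unfolding g(1) h(1) by blast
  qed (auto intro: exI[of _ "s a"])
qed

section \<open>The colouring algorithm\<close>

abbreviation root :: sexp where "root \<equiv> Cell 4 (Num 0)"
abbreviation anchor :: sexp where "anchor \<equiv> Cell 5 (Num 0)"
abbreviation label :: "sexp \<Rightarrow> sexp" where "label \<equiv> Cell 8"

text \<open>The sum computes the row offset, as the language has no multiplication. It binds variable 9, which
  must not occur in \<open>d\<close>; likewise \<open>Leaf\<close> binds variable 8.\<close>

definition Adj :: "sexp \<Rightarrow> sexp \<Rightarrow> sexp" where
  "Adj d e = Cell 1 (Plus (Sum 9 d) e)"

definition Outer :: "sexp \<Rightarrow> sexp" where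
  "Outer d = And (Neg (Eq d root)) (Neg (Adj root d))"

definition Leaf :: "sexp \<Rightarrow> sexp" where
  "Leaf d = And (Adj root d) (Neg (Sum 8 (And (Neg (Eq (Var 8) root)) (Adj d (Var 8)))))"

definition degree_stage :: stmt where
  "degree_stage = For 0 (Assign 3 (Var 0) (Sum 1 (Adj (Var 0) (Var 1))))"

definition root_stage :: stmt where
  "root_stage = For 0 (Assign 4 (Num 0) (Cond
     (Neg (Sum 1 (Less (Cell 3 (Var 0)) (Cell 3 (Var 1))))) (Var 0) root))"

definition anchor_stage :: stmt where
  "anchor_stage = For 0 (Assign 5 (Num 0) (Cond
     (And (Adj root (Var 0)) (Sum 1 (And (Outer (Var 1)) (Adj (Var 0) (Var 1))))) (Var 0) anchor))"

text \<open>Seeding with the anchor forces it into the clique. Without an anchor the seed is simply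
  whatever vertex cell 0 of array 5 names, hence the exception for the seed in the description of
  the result.\<close>

definition clique_stage :: stmt where
  "clique_stage = Assign 6 anchor (Num 1) ;; For 0 (Assign 6 (Var 0) (Cond
     (And (Adj root (Var 0)) (Neg (Sum 1 (And (Cell 6 (Var 1)) (Neg (Adj (Var 0) (Var 1)))))))
     (Num 1) (Cell 6 (Var 0))))"

definition independent_stage :: stmt where
  "independent_stage = For 0 (Assign 7 (Var 0) (Cond
     (And (Adj root (Var 0)) (Neg (Sum 1 (And (Cell 7 (Var 1)) (Adj (Var 0) (Var 1))))))
     (Num 1) (Cell 7 (Var 0))))"

definition label_stage :: stmt where
  "label_stage = For 0 (Assign 8 (Var 0)
     (Cond (Eq (Var 0) root) (Num 0)
     (Cond (Outer (Var 0)) (Num 5)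
     (Cond (Sum 1 (Outer (Var 1))) (Cond (Cell 6 (Var 0)) (Num 1) (Num 2))
     (Cond (Leaf (Var 0)) (Cond (Sum 1 (And (Less (Var 1) (Var 0)) (Leaf (Var 1)))) (Num 4) (Num 3))
     (Cond (Cell 7 (Var 0)) (Num 1) (Num 2)))))))"

definition Opposite :: "sexp \<Rightarrow> sexp" where
  "Opposite e = Eq (label e) (Minus (Num 3) (label (Var 1)))"

text \<open>Variable 0 is the outer vertex and variable 1 its parent. The parent must see the
  opposite side, while the outer vertex must be detached from it.\<close>

definition Flippable :: sexp where
  "Flippable = And (And (Eq (label (Var 0)) (Num 5)) (And (Adj root (Var 1)) (Adj (Var 0) (Var 1))))
     (And (Sum 2 (And (Opposite (Var 2)) (Adj (Var 1) (Var 2))))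
       (Neg (Sum 2 (And (Opposite (Var 2)) (Plus (Adj (Var 0) (Var 2))
         (Sum 3 (And (Eq (label (Var 3)) (Num 5)) (And (Adj (Var 0) (Var 3)) (Adj (Var 3) (Var 2))))))))))"

definition flip_stage :: stmt where
  "flip_stage = For 0 (For 1 (Assign 9 (Var 0)
     (Cond Flippable (Plus (Var 1) (Num 1)) (Cell 9 (Var 0)))))"

text \<open>On side \<open>s\<close> the plain colour is \<open>2 + s\<close>; a recoloured edge
  takes \<open>5 - s\<close>, the plain colour of the other side.\<close>

definition Down :: "sexp \<Rightarrow> sexp \<Rightarrow> sexp" where
  "Down d e = Cond (Eq (Cell 9 d) (Plus e (Num 1))) (Minus (Num 5) (label e)) (Plus (Num 2) (label e))"

definition Color :: "sexp \<Rightarrow> sexp \<Rightarrow> sexp" where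
  "Color d e = Cond (Eq d root) (label e) (Cond (Eq e root) (label d)
     (Cond (Eq (label d) (Num 5)) (Cond (Eq (label e) (Num 5)) (Num 5) (Down d e))
     (Cond (Eq (label e) (Num 5)) (Down e d) (Num 5))))"

definition color_stage :: stmt where
  "color_stage = For 0 (For 1 (Assign 2 (Plus (Sum 9 (Var 0)) (Var 1)) (Color (Var 0) (Var 1))))"

text \<open>Arrays 3 to 9 hold, in this order, the degrees, root, anchor, clique, independent set,
  labels and recoloured edges; array 2 receives the colouring.\<close>

definition program :: stmt where
  "program = degree_stage ;; root_stage ;; anchor_stage ;; clique_stage ;; independent_stage ;;
     label_stage ;; flip_stage ;; color_stage"

lemma arrs_simps [simp]:
  "arrs (Neg e) = arrs e"
  "arrs (And d e) = arrs d \<union> arrs e"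
  "arrs (Less d e) = arrs d \<union> arrs e"
  "arrs (Eq d e) = arrs d \<union> arrs e"
  "arrs (Adj d e) = insert 1 (arrs d \<union> arrs e)"
  "arrs (Outer e) = {1, 4} \<union> arrs e"
  "arrs (Leaf e) = {1, 4} \<union> arrs e"
  "arrs (Opposite e) = insert 8 (arrs e)"
  "arrs Flippable = {1, 4, 8}"
  "arrs (Down d e) = {8, 9} \<union> arrs d \<union> arrs e"
  "arrs (Color d e) = {4, 8, 9} \<union> arrs d \<union> arrs e"
  by (auto simp: macros Adj_def Outer_def Leaf_def Opposite_def Flippable_def Down_def Color_def)

lemmas [simp del] = sem.simps(3)

lemmas stage_defs = degree_stage_def root_stage_def anchor_stage_def clique_stage_def
  independent_stage_def label_stage_def flip_stage_def color_stage_def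

text \<open>Scratch space may start at array 10, and the loop bound is never overwritten.\<close>

lemma program_arrays: "a \<in> reads program \<union> writes program \<Longrightarrow> a < 10" "0 \<notin> writes program"
  by (auto simp: program_def stage_defs)

section \<open>Meaning of the stages in terms of adjacency\<close>

locale adjacency_matrix =
  fixes n :: nat and M :: "nat \<Rightarrow> nat"
  assumes bool: "M i \<le> 1"
    and symmetric: "\<lbrakk>i < n; j < n; M (n * i + j) \<noteq> 0\<rbrakk> \<Longrightarrow> M (n * j + i) \<noteq> 0"
begin

definition adj :: "nat \<Rightarrow> nat \<Rightarrow> bool" where
  "adj i j \<longleftrightarrow> M (n * i + j) \<noteq> 0"

definition deg :: "nat \<Rightarrow> nat" where
  "deg i = card {j. j < n \<and> adj i j}"

definition loaded :: "memory \<Rightarrow> bool" where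
  "loaded s \<longleftrightarrow> s 0 0 = n \<and> s 1 = M"

lemma loadedD [simp]: "loaded s \<Longrightarrow> s 0 0 = n"
  by (simp add: loaded_def)

lemma loaded_upd [simp]: "loaded s \<Longrightarrow> a > 1 \<Longrightarrow> loaded (s(a := g))"
  by (simp add: loaded_def)

text \<open>The second hypothesis expresses semantically that variable 9, bound by the row offset,
  does not occur in \<open>d\<close>.\<close>

lemma holds_Adj [simp]:
  assumes "loaded s" "\<And>k. ev d s (\<sigma>(9 := k)) = ev d s \<sigma>"
  shows "holds (Adj d e) s \<sigma> \<longleftrightarrow> adj (ev d s \<sigma>) (ev e s \<sigma>)"
  using assms by (simp add: Adj_def holds_Cell adj_def loaded_def)

lemma holds_Outer [simp]:
  assumes "loaded s"
  shows "holds (Outer d) s \<sigma> \<longleftrightarrow> ev d s \<sigma> \<noteq> s 4 0 \<and> \<not> adj (s 4 0) (ev d s \<sigma>)"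
  using assms by (simp add: Outer_def)

lemma holds_Leaf [simp]:
  assumes "loaded s" "\<And>k. ev d s (\<sigma>(8 := k)) = ev d s \<sigma>" "\<And>k l. ev d s (\<sigma>(8 := k, 9 := l)) = ev d s \<sigma>"
  shows "holds (Leaf d) s \<sigma> \<longleftrightarrow> adj (s 4 0) (ev d s \<sigma>) \<and> \<not> (\<exists>j<n. j \<noteq> s 4 0 \<and> adj (ev d s \<sigma>) j)"
  using assms by (simp add: Leaf_def)

text \<open>Matrix entries are 0 or 1, so a row sum is a degree.\<close>

lemma degree_stage:
  assumes "loaded s"
  shows "\<exists>g. sem degree_stage s \<sigma> = s(3 := g) \<and> (\<forall>i<n. g i = deg i)"
proof -
  have "ev (Sum 1 (Adj (Var 0) (Var 1))) s (\<sigma>(0 := i)) = deg i" for i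
  proof -
    have "ev (Sum 1 (Adj (Var 0) (Var 1))) s (\<sigma>(0 := i)) = (\<Sum>j<n. M (n * i + j))"
      using assms by (simp add: Adj_def loaded_def)
    also have "\<dots> = (\<Sum>j<n. if adj i j then 1 else 0)"
    proof (rule sum.cong)
      show "M (n * i + j) = (if adj i j then 1 else 0)" for j
        using bool[of "n * i + j"] by (auto simp: adj_def)
    qed simp
    also have "\<dots> = deg i"
      by (simp add: deg_def sum.If_cases Collect_conj_eq lessThan_def)
    finally show ?thesis .
  qed
  then show ?thesis
    unfolding degree_stage_def
    by (subst sem_map) (use assms in \<open>auto intro!: exI\<close>)
qed

lemma ex_max_deg: "0 < n \<Longrightarrow> \<exists>i<n. \<forall>j<n. deg j \<le> deg i"
proof -
  assume "0 < n"
  then have "Max (deg ` {..<n}) \<in> deg ` {..<n}" by (intro Max_in) auto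
  then obtain i where i: "i < n" "deg i = Max (deg ` {..<n})" by auto
  have "deg j \<le> deg i" if "j < n" for j
    unfolding i(2) using that by (intro Max_ge) auto
  with i(1) show ?thesis by blast
qed

lemma root_stage:
  assumes "loaded s" "0 < n" "\<forall>i<n. s 3 i = deg i"
  shows "\<exists>v. sem root_stage s \<sigma> = s(4 := (s 4)(0 := v)) \<and> v < n \<and> (\<forall>j<n. deg j \<le> deg v)"
proof -
  have max: "holds (Neg (Sum 1 (Less (Cell 3 (Var 0)) (Cell 3 (Var 1))))) s (\<sigma>(0 := i)) \<longleftrightarrow>
      (\<forall>j<n. deg j \<le> deg i)" if "i < n" for i
  proof -
    have "holds (Neg (Sum 1 (Less (Cell 3 (Var 0)) (Cell 3 (Var 1))))) s (\<sigma>(0 := i)) \<longleftrightarrow>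
        \<not> (\<exists>j<n. s 3 i < s 3 j)"
      using assms(1) by simp
    also have "\<dots> \<longleftrightarrow> (\<forall>j<n. s 3 j \<le> s 3 i)"
      by (meson not_less)
    finally show ?thesis using assms(3) that by simp
  qed
  have "\<exists>y. sem root_stage s \<sigma> = s(4 := (s 4)(0 := y)) \<and>
    ((\<exists>i<n. (\<forall>j<n. deg j \<le> deg i) \<and> y = i) \<or> (\<forall>i<n. \<not> (\<forall>j<n. deg j \<le> deg i)) \<and> y = s 4 0)"
    unfolding root_stage_def
    using sem_pick[of 4 "Neg (Sum 1 (Less (Cell 3 (Var 0)) (Cell 3 (Var 1))))" "Var 0" "Num 0" s \<sigma> 0 0]
      assms(1) max by (simp del: holds_simps) blast
  then show ?thesis using ex_max_deg[OF assms(2)] by auto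
qed

definition outer :: "nat \<Rightarrow> nat \<Rightarrow> bool" where
  "outer v d \<longleftrightarrow> d \<noteq> v \<and> \<not> adj v d"

definition anchored :: "nat \<Rightarrow> nat \<Rightarrow> bool" where
  "anchored v x \<longleftrightarrow> adj v x \<and> (\<exists>d<n. outer v d \<and> adj x d)"

lemma anchor_stage:
  assumes "loaded s"
  shows "\<exists>x. sem anchor_stage s \<sigma> = s(5 := (s 5)(0 := x)) \<and>
    ((\<exists>i<n. anchored (s 4 0) i) \<longrightarrow> x < n \<and> anchored (s 4 0) x)"
proof -
  have "\<exists>y. sem anchor_stage s \<sigma> = s(5 := (s 5)(0 := y)) \<and>
    ((\<exists>i<n. anchored (s 4 0) i \<and> y = i) \<or> (\<forall>i<n. \<not> anchored (s 4 0) i) \<and> y = s 5 0)"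
    unfolding anchor_stage_def
    using sem_pick[of 5 "And (Adj root (Var 0)) (Sum 1 (And (Outer (Var 1)) (Adj (Var 0) (Var 1))))"
        "Var 0" "Num 0" s \<sigma> 0 0] assms
    by (simp add: anchored_def outer_def)
  then show ?thesis by auto
qed

lemma adj_sym: "i < n \<Longrightarrow> j < n \<Longrightarrow> adj i j \<Longrightarrow> adj j i"
  using symmetric by (simp add: adj_def)

text \<open>The greedy rule with non-adjacency as conflict, started from the anchor.\<close>

lemma clique_stage:
  assumes "loaded s" "s 6 = (\<lambda>_. 0)"
  shows "\<exists>g. sem clique_stage s \<sigma> = s(6 := g) \<and> (s 5 0 < n \<longrightarrow> g (s 5 0) \<noteq> 0) \<and>
    (\<forall>i<n. (g i \<noteq> 0 \<longrightarrow> i = s 5 0 \<or> adj (s 4 0) i) \<and>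
      (adj (s 4 0) i \<longrightarrow> g i \<noteq> 0 \<or> (\<exists>j<n. g j \<noteq> 0 \<and> \<not> adj i j)) \<and>
      (\<forall>j<n. i \<noteq> j \<and> g i \<noteq> 0 \<and> g j \<noteq> 0 \<longrightarrow> adj i j))"
proof -
  define t where "t = s(6 := (\<lambda>_. 0)(s 5 0 := 1))"
  have t: "loaded t" "sem (Assign 6 anchor (Num 1)) s \<sigma> = t" "t 4 = s 4"
    "\<And>i. t 6 i \<noteq> 0 \<longleftrightarrow> i = s 5 0"
    using assms by (auto simp: t_def put_def)
  have up: "t(6 := g) = s(6 := g)" for g by (simp add: t_def)
  have "\<exists>g. sem (For 0 (Assign 6 (Var 0) (Cond
      (And (Adj root (Var 0)) (Neg (Sum 1 (And (Cell 6 (Var 1)) (Neg (Adj (Var 0) (Var 1)))))))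
      (Num 1) (Cell 6 (Var 0))))) t \<sigma> = t(6 := g) \<and>
    (\<forall>i<n. (t 6 i \<noteq> 0 \<longrightarrow> g i \<noteq> 0) \<and> (g i \<noteq> 0 \<longrightarrow> t 6 i \<noteq> 0 \<or> adj (s 4 0) i) \<and>
      (adj (s 4 0) i \<longrightarrow> g i \<noteq> 0 \<or> (\<exists>j<n. g j \<noteq> 0 \<and> \<not> adj i j)) \<and>
      (\<forall>j<n. i \<noteq> j \<and> g i \<noteq> 0 \<and> g j \<noteq> 0 \<longrightarrow> adj i j))"
  proof -
    have eq: "holds (Adj root (Var 0)) t (\<sigma>(0 := i)) \<longleftrightarrow> adj (s 4 0) i"
      "holds (Neg (Adj (Var 0) (Var 1))) t (\<sigma>(0 := i, 1 := j)) \<longleftrightarrow> \<not> adj i j" "t 0 0 = n" for i j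
      using t(1,3) by auto
    show ?thesis
      by (rule sem_greedy[where a=6 and x=0 and y=1 and s=t and \<sigma>=\<sigma> and b="Adj root (Var 0)"
        and r="Neg (Adj (Var 0) (Var 1))", unfolded eq not_not]) (use adj_sym t(4) in auto)
  qed
  then obtain g where g: "sem (For 0 (Assign 6 (Var 0) (Cond
      (And (Adj root (Var 0)) (Neg (Sum 1 (And (Cell 6 (Var 1)) (Neg (Adj (Var 0) (Var 1)))))))
      (Num 1) (Cell 6 (Var 0))))) t \<sigma> = t(6 := g)"
    "\<forall>i<n. (t 6 i \<noteq> 0 \<longrightarrow> g i \<noteq> 0) \<and> (g i \<noteq> 0 \<longrightarrow> t 6 i \<noteq> 0 \<or> adj (s 4 0) i) \<and>
      (adj (s 4 0) i \<longrightarrow> g i \<noteq> 0 \<or> (\<exists>j<n. g j \<noteq> 0 \<and> \<not> adj i j)) \<and>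
      (\<forall>j<n. i \<noteq> j \<and> g i \<noteq> 0 \<and> g j \<noteq> 0 \<longrightarrow> adj i j)" by blast
  have "sem clique_stage s \<sigma> = s(6 := g)"
    unfolding clique_stage_def sem.simps(2) t(2) g(1) up ..
  moreover have "s 5 0 < n \<longrightarrow> g (s 5 0) \<noteq> 0" using g(2) t(4) by blast
  ultimately show ?thesis using g(2) t(4) by (intro exI[of _ g]) auto
qed

text \<open>The greedy rule with adjacency as conflict, started from the empty set.\<close>

lemma independent_stage:
  assumes "loaded s" "s 7 = (\<lambda>_. 0)"
  shows "\<exists>g. sem independent_stage s \<sigma> = s(7 := g) \<and>
    (\<forall>i<n. (adj (s 4 0) i \<longrightarrow> g i \<noteq> 0 \<or> (\<exists>j<n. g j \<noteq> 0 \<and> adj i j)) \<and> (g i \<noteq> 0 \<longrightarrow> adj (s 4 0) i) \<and>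
      (\<forall>j<n. i \<noteq> j \<and> g i \<noteq> 0 \<and> g j \<noteq> 0 \<longrightarrow> \<not> adj i j))"
proof -
  have eq: "holds (Adj root (Var 0)) s (\<sigma>(0 := i)) \<longleftrightarrow> adj (s 4 0) i"
    "holds (Adj (Var 0) (Var 1)) s (\<sigma>(0 := i, 1 := j)) \<longleftrightarrow> adj i j" "s 0 0 = n" for i j
    using assms(1) by auto
  have "\<exists>g. sem independent_stage s \<sigma> = s(7 := g) \<and>
      (\<forall>i<n. (s 7 i \<noteq> 0 \<longrightarrow> g i \<noteq> 0) \<and> (g i \<noteq> 0 \<longrightarrow> s 7 i \<noteq> 0 \<or> adj (s 4 0) i) \<and>
        (adj (s 4 0) i \<longrightarrow> g i \<noteq> 0 \<or> (\<exists>j<n. g j \<noteq> 0 \<and> adj i j)) \<and>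
        (\<forall>j<n. i \<noteq> j \<and> g i \<noteq> 0 \<and> g j \<noteq> 0 \<longrightarrow> \<not> adj i j))"
    unfolding independent_stage_def
    by (rule sem_greedy[where a=7 and x=0 and y=1 and s=s and \<sigma>=\<sigma> and b="Adj root (Var 0)"
      and r="Adj (Var 0) (Var 1)", unfolded eq]) (use adj_sym assms(2) in auto)
  then show ?thesis using assms(2) by auto
qed

definition leaf :: "nat \<Rightarrow> nat \<Rightarrow> bool" where
  "leaf v i \<longleftrightarrow> adj v i \<and> \<not> (\<exists>j<n. j \<noteq> v \<and> adj i j)"

text \<open>Among the leaves, the smallest gets 3 and any other gets 4; these labels are private
  once there are at most two leaves.\<close>

definition labelling :: "nat \<Rightarrow> (nat \<Rightarrow> nat) \<Rightarrow> (nat \<Rightarrow> nat) \<Rightarrow> nat \<Rightarrow> nat" where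
  "labelling v X Z i = (if i = v then 0 else if outer v i then 5
     else if \<exists>d<n. outer v d then (if X i \<noteq> 0 then 1 else 2)
     else if leaf v i then (if \<exists>j<n. j < i \<and> leaf v j then 4 else 3)
     else if Z i \<noteq> 0 then 1 else 2)"

lemma label_stage:
  assumes "loaded s"
  shows "\<exists>g. sem label_stage s \<sigma> = s(8 := g) \<and> (\<forall>i<n. g i = labelling (s 4 0) (s 6) (s 7) i)"
  unfolding label_stage_def
  by (subst sem_map)
    (use assms in \<open>auto simp: labelling_def leaf_def outer_def holds_Cell cong: if_cong intro!: exI\<close>)

definition flippable :: "nat \<Rightarrow> (nat \<Rightarrow> nat) \<Rightarrow> nat \<Rightarrow> nat \<Rightarrow> bool" where
  "flippable v L d w \<longleftrightarrow> (L d = 5 \<and> adj v w \<and> adj d w) \<and>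
     (\<exists>z<n. L z = 3 - L w \<and> adj w z) \<and>
     \<not> (\<exists>z<n. L z = 3 - L w \<and> (adj d z \<or> (\<exists>e<n. L e = 5 \<and> adj d e \<and> adj e z)))"

lemma flip_stage:
  assumes "loaded s" "s 9 = (\<lambda>_. 0)"
  shows "\<exists>m. sem flip_stage s \<sigma> = s(9 := m) \<and>
    (\<forall>i<n. (\<exists>j<n. flippable (s 4 0) (s 8) i j \<and> m i = Suc j) \<or>
      (\<forall>j<n. \<not> flippable (s 4 0) (s 8) i j) \<and> m i = 0)"
proof -
  have "holds Flippable s (\<sigma>(0 := i, 1 := j)) \<longleftrightarrow> flippable (s 4 0) (s 8) i j" for i j
    using assms(1) by (simp add: Flippable_def flippable_def Opposite_def)
  then show ?thesis
    unfolding flip_stage_def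
    using sem_pick2[of 9 Flippable "Plus (Var 1) (Num 1)" 0 1 s \<sigma>] assms by simp
qed

definition down :: "(nat \<Rightarrow> nat) \<Rightarrow> (nat \<Rightarrow> nat) \<Rightarrow> nat \<Rightarrow> nat \<Rightarrow> nat" where
  "down L m d w = (if m d = Suc w then 5 - L w else 2 + L w)"

definition color :: "nat \<Rightarrow> (nat \<Rightarrow> nat) \<Rightarrow> (nat \<Rightarrow> nat) \<Rightarrow> nat \<Rightarrow> nat \<Rightarrow> nat" where
  "color v L m u w = (if u = v then L w else if w = v then L u
     else if L u = 5 then (if L w = 5 then 5 else down L m u w)
     else if L w = 5 then down L m w u else 5)"

lemma color_stage:
  assumes "loaded s"
  shows "\<exists>h. sem color_stage s \<sigma> = s(2 := h) \<and>
    (\<forall>u<n. \<forall>w<n. h (n * u + w) = color (s 4 0) (s 8) (s 9) u w)"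
proof -
  have "ev (Color (Var 0) (Var 1)) s (\<sigma>(0 := u, 1 := w)) = color (s 4 0) (s 8) (s 9) u w" for u w
    by (simp add: Color_def color_def Down_def down_def)
  then show ?thesis
    unfolding color_stage_def
    using sem_matrix[of 2 "Color (Var 0) (Var 1)" 0 1 9 s \<sigma>] assms by simp
qed

text \<open>\<open>m d\<close> encodes the partner \<open>w\<close> of \<open>d\<close> as \<open>Suc w\<close>, and its absence as 0.\<close>

lemma program_result:
  assumes "loaded s" "0 < n" "\<And>a. a > 1 \<Longrightarrow> s a = (\<lambda>_. 0)"
  obtains v x X Z L m where
    "v < n" "\<forall>j<n. deg j \<le> deg v"
    "(\<exists>i<n. anchored v i) \<longrightarrow> x < n \<and> anchored v x"
    "x < n \<longrightarrow> X x \<noteq> (0::nat)"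
    "\<forall>i<n. (X i \<noteq> 0 \<longrightarrow> i = x \<or> adj v i) \<and>
      (adj v i \<longrightarrow> X i \<noteq> 0 \<or> (\<exists>j<n. X j \<noteq> 0 \<and> \<not> adj i j)) \<and>
      (\<forall>j<n. i \<noteq> j \<and> X i \<noteq> 0 \<and> X j \<noteq> 0 \<longrightarrow> adj i j)"
    "\<forall>i<n. (adj v i \<longrightarrow> Z i \<noteq> 0 \<or> (\<exists>j<n. Z j \<noteq> 0 \<and> adj i j)) \<and> (Z i \<noteq> (0::nat) \<longrightarrow> adj v i) \<and>
      (\<forall>j<n. i \<noteq> j \<and> Z i \<noteq> 0 \<and> Z j \<noteq> 0 \<longrightarrow> \<not> adj i j)"
    "\<forall>i<n. L i = labelling v X Z i"
    "\<forall>i<n. (\<exists>j<n. flippable v L i j \<and> m i = Suc j) \<or> (\<forall>j<n. \<not> flippable v L i j) \<and> m i = 0"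
    "\<forall>u<n. \<forall>w<n. sem program s \<sigma> 2 (n * u + w) = color v L m u w"
proof -
  obtain g where s1: "sem degree_stage s \<sigma> = s(3 := g)" "\<forall>i<n. g i = deg i"
    using degree_stage assms by blast
  define s1 where "s1 = s(3 := g)"
  obtain v where s2: "sem root_stage s1 \<sigma> = s1(4 := (s1 4)(0 := v))" "v < n" "\<forall>j<n. deg j \<le> deg v"
    using root_stage[of s1 \<sigma>] s1 assms by (auto simp: s1_def)
  define s2 where "s2 = s1(4 := (s1 4)(0 := v))"
  have 2: "s2 4 0 = v" "loaded s2" using assms by (auto simp: s2_def s1_def)
  obtain x where s3: "sem anchor_stage s2 \<sigma> = s2(5 := (s2 5)(0 := x))"
    "(\<exists>i<n. anchored v i) \<longrightarrow> x < n \<and> anchored v x"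
    using anchor_stage[of s2 \<sigma>] 2 by auto
  define s3 where "s3 = s2(5 := (s2 5)(0 := x))"
  have 3: "s3 4 0 = v" "s3 5 0 = x" "loaded s3" "s3 6 = (\<lambda>_. 0)"
    using 2 assms by (auto simp: s3_def s2_def s1_def)
  obtain X where s4: "sem clique_stage s3 \<sigma> = s3(6 := X)" and X: "x < n \<longrightarrow> X x \<noteq> (0::nat)"
    "\<forall>i<n. (X i \<noteq> 0 \<longrightarrow> i = x \<or> adj v i) \<and>
      (adj v i \<longrightarrow> X i \<noteq> 0 \<or> (\<exists>j<n. X j \<noteq> 0 \<and> \<not> adj i j)) \<and>
      (\<forall>j<n. i \<noteq> j \<and> X i \<noteq> 0 \<and> X j \<noteq> 0 \<longrightarrow> adj i j)"
    using clique_stage[OF 3(3,4), of \<sigma>] unfolding 3(1,2) by blast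
  define s4 where "s4 = s3(6 := X)"
  have 4: "s4 4 0 = v" "loaded s4" "s4 7 = (\<lambda>_. 0)"
    using 3 assms by (auto simp: s4_def s3_def s2_def s1_def)
  obtain Z where s5: "sem independent_stage s4 \<sigma> = s4(7 := Z)" and Z:
    "\<forall>i<n. (adj v i \<longrightarrow> Z i \<noteq> 0 \<or> (\<exists>j<n. Z j \<noteq> 0 \<and> adj i j)) \<and> (Z i \<noteq> (0::nat) \<longrightarrow> adj v i) \<and>
      (\<forall>j<n. i \<noteq> j \<and> Z i \<noteq> 0 \<and> Z j \<noteq> 0 \<longrightarrow> \<not> adj i j)"
    using independent_stage[OF 4(2,3), of \<sigma>] unfolding 4(1) by blast
  define s5 where "s5 = s4(7 := Z)"
  have 5: "s5 4 0 = v" "loaded s5" "s5 6 = X" "s5 7 = Z"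
    using 4 by (auto simp: s5_def s4_def)
  obtain L where s6: "sem label_stage s5 \<sigma> = s5(8 := L)" and L: "\<forall>i<n. L i = labelling v X Z i"
    using label_stage[OF 5(2), of \<sigma>] unfolding 5 by blast
  define s6 where "s6 = s5(8 := L)"
  have 6: "s6 4 0 = v" "loaded s6" "s6 8 = L" "s6 9 = (\<lambda>_. 0)"
    using 5 assms by (auto simp: s6_def s5_def s4_def s3_def s2_def s1_def)
  obtain m where s7: "sem flip_stage s6 \<sigma> = s6(9 := m)" and m:
    "\<forall>i<n. (\<exists>j<n. flippable v L i j \<and> m i = Suc j) \<or> (\<forall>j<n. \<not> flippable v L i j) \<and> m i = 0"
    using flip_stage[OF 6(2,4), of \<sigma>] unfolding 6 by blast
  define s7 where "s7 = s6(9 := m)"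
  have 7: "s7 4 0 = v" "loaded s7" "s7 8 = L" "s7 9 = m" using 6 by (auto simp: s7_def)
  have "\<forall>u<n. \<forall>w<n. sem color_stage s7 \<sigma> 2 (n * u + w) = color v L m u w"
    using color_stage[OF 7(2), of \<sigma>] unfolding 7 by auto
  moreover have "sem program s \<sigma> = sem color_stage s7 \<sigma>"
    using s1(1) s2(1) s3(1) s4 s5 s6 s7
    by (simp add: program_def s1_def s2_def s3_def s4_def s5_def s6_def s7_def)
  ultimately show thesis
    using that[of v x X Z L m] s2(2,3) s3(2) X Z L m by simp
qed

end

section \<open>Correctness of the computed colouring\<close>

lemma input_index:
  assumes "simple_graph {..<n} E" "i < n" "j < n"
  shows "input n E 1 (n * i + j) \<noteq> 0 \<longleftrightarrow> {i, j} \<in> E"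
proof -
  have "(\<exists>u<n. \<exists>w<n. n * i + j = u * n + w \<and> {u, w} \<in> E) \<longleftrightarrow> {i, j} \<in> E"
    using assms(2,3) row_index_inj[of n i j] by (metis mult.commute)
  then show ?thesis by (simp add: input_def)
qed

text \<open>Collects what a run of the program guarantees, so that the colouring can be analysed
  without reference to memories.\<close>

locale solved_graph = diameter_two "{..<n}" E + adjacency_matrix n M
  for n :: nat and E :: "nat set set" and M :: "nat \<Rightarrow> nat" +
  fixes v x :: nat and X Z L m :: "nat \<Rightarrow> nat" and c :: "nat set \<Rightarrow> nat"
  assumes M: "\<lbrakk>i < n; j < n\<rbrakk> \<Longrightarrow> M (n * i + j) \<noteq> 0 \<longleftrightarrow> {i, j} \<in> E"
    and v: "v < n" and max_deg: "\<And>j. j < n \<Longrightarrow> deg j \<le> deg v"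
    and anchor: "(\<exists>i<n. anchored v i) \<Longrightarrow> x < n \<and> anchored v x"
    and X_anchor: "x < n \<Longrightarrow> X x \<noteq> 0"
    and X: "\<And>i. i < n \<Longrightarrow> X i \<noteq> 0 \<Longrightarrow> i = x \<or> adj v i"
      "\<And>i. i < n \<Longrightarrow> adj v i \<Longrightarrow> X i \<noteq> 0 \<or> (\<exists>j<n. X j \<noteq> 0 \<and> \<not> adj i j)"
      "\<And>i j. i < n \<Longrightarrow> j < n \<Longrightarrow> i \<noteq> j \<Longrightarrow> X i \<noteq> 0 \<Longrightarrow> X j \<noteq> 0 \<Longrightarrow> adj i j"
    and Z: "\<And>i. i < n \<Longrightarrow> adj v i \<Longrightarrow> Z i \<noteq> 0 \<or> (\<exists>j<n. Z j \<noteq> 0 \<and> adj i j)"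
      "\<And>i. i < n \<Longrightarrow> Z i \<noteq> 0 \<Longrightarrow> adj v i"
      "\<And>i j. i < n \<Longrightarrow> j < n \<Longrightarrow> i \<noteq> j \<Longrightarrow> Z i \<noteq> 0 \<Longrightarrow> Z j \<noteq> 0 \<Longrightarrow> \<not> adj i j"
    and L: "\<And>i. i < n \<Longrightarrow> L i = labelling v X Z i"
    and m: "\<And>i. i < n \<Longrightarrow> (\<exists>j<n. flippable v L i j \<and> m i = Suc j) \<or>
        (\<forall>j<n. \<not> flippable v L i j) \<and> m i = 0"
    and c: "\<And>u w. \<lbrakk>u < n; w < n; u \<noteq> w\<rbrakk> \<Longrightarrow> c {u, w} = color v L m u w"
begin

lemma adj_edge: "\<lbrakk>i < n; j < n\<rbrakk> \<Longrightarrow> adj i j \<longleftrightarrow> {i, j} \<in> E"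
  using M by (simp add: adj_def)

lemma edge_adj: "{i, j} \<in> E \<Longrightarrow> i < n \<and> j < n \<and> i \<noteq> j \<and> adj i j \<and> adj j i"
  using edge_verts[of i j] edge_sym[of i j] adj_edge by auto

lemma adj_irrefl: "i < n \<Longrightarrow> \<not> adj i i"
  using adj_edge edge_verts by blast

lemma L_root: "L v = 0"
  using L v by (simp add: labelling_def)

lemma L_outer: "d < n \<Longrightarrow> L d = 5 \<longleftrightarrow> outer v d"
  using L by (simp add: labelling_def outer_def)

lemma L_zero: "i < n \<Longrightarrow> L i = 0 \<longleftrightarrow> i = v"
  using L by (auto simp: labelling_def)

lemma inner_non_neighbour:
  assumes "w < n" "adj v w" "d < n" "outer v d" "adj w d"
  shows "\<exists>z<n. adj v z \<and> z \<noteq> w \<and> \<not> adj w z"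
proof (rule ccontr)
  assume contra: "\<not> ?thesis"
  let ?N = "{j. j < n \<and> adj v j}"
  \<comment> \<open>If \<open>w\<close> saw all the rest of the neighbourhood of \<open>v\<close>,
    then together with \<open>v\<close> and \<open>d\<close> it would have one neighbour more than
    \<open>v\<close>.\<close>
  have "insert v (insert d (?N - {w})) \<subseteq> {j. j < n \<and> adj w j}"
    using contra assms v adj_sym by auto
  then have "card (insert v (insert d (?N - {w}))) \<le> deg w"
    unfolding deg_def by (intro card_mono) auto
  moreover have "card (insert v (insert d (?N - {w}))) = Suc (Suc (card (?N - {w})))"
    using assms adj_irrefl v by (auto simp: outer_def card_insert_if)
  moreover have "Suc (card (?N - {w})) = deg v"
    unfolding deg_def using assms by (intro card_Suc_Diff1) auto
  ultimately show False using max_deg[of w] assms by simp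
qed

section \<open>The case of a vertex at distance two from the root\<close>

context
  fixes e assumes e: "e < n" "outer v e"
begin

lemma L_inner: "i < n \<Longrightarrow> adj v i \<Longrightarrow> L i = (if X i \<noteq> 0 then 1 else 2)"
  using L e adj_irrefl[of v] v by (auto simp: labelling_def outer_def)

lemma L_inner_iff: "i < n \<Longrightarrow> L i \<in> {1, 2} \<longleftrightarrow> adj v i"
  using L e adj_irrefl[of v] v L_inner[of i] by (auto simp: labelling_def outer_def)

lemma L_one: "i < n \<Longrightarrow> L i = 1 \<Longrightarrow> X i \<noteq> 0"
proof -
  assume i: "i < n" "L i = 1"
  then have "adj v i" using L_inner_iff[of i] by simp
  then show ?thesis using L_inner[of i] i by (cases "X i = 0") simp_all
qed

lemma L_range: "i < n \<Longrightarrow> L i \<in> {0, 1, 2, 5}"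
  using L_root L_outer[of i] L_inner[of i] by (cases "i = v"; cases "outer v i") (auto simp: outer_def)

text \<open>A common neighbour of \<open>v\<close> and \<open>e\<close> is anchored, so the search
  for an anchor succeeds.\<close>

lemma x_anchored: "x < n" "anchored v x"
proof -
  have "{v, e} \<notin> E" using adj_edge v e by (auto simp: outer_def)
  then obtain i where "i < n" "{v, i} \<in> E" "{i, e} \<in> E"
    using two_step[of v e] v e by (auto simp: outer_def)
  then have "anchored v i" using e edge_adj by (auto simp: anchored_def)
  then show "x < n" "anchored v x" using anchor \<open>i < n\<close> by blast+
qed

lemma X_adj: "i < n \<Longrightarrow> X i \<noteq> 0 \<Longrightarrow> adj v i"
  using X(1) x_anchored by (auto simp: anchored_def)

text \<open>Outside the clique, maximality of the clique gives the non-neighbour. Inside it, the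
  degree argument gives a non-neighbour in the neighbourhood of \<open>v\<close>, which cannot
  belong to the clique.\<close>

lemma X_opposite:
  assumes "d < n" "outer v d" "w < n" "adj v w" "adj w d"
  shows "\<exists>z<n. L z = 3 - L w \<and> \<not> adj w z"
proof (cases "X w = 0")
  case True
  then obtain j where "j < n" "X j \<noteq> 0" "\<not> adj w j" using X(2) assms by blast
  then show ?thesis using X_adj[of j] L_inner[of j] L_inner[of w] assms True by auto
next
  case False
  obtain z where "z < n" "adj v z" "z \<noteq> w" "\<not> adj w z"
    using inner_non_neighbour assms by blast
  moreover from this have "X z = 0" using X(3)[of w z] False assms by auto
  ultimately show ?thesis using L_inner[of z] L_inner[of w] assms False by auto
qed

lemma flip_flippable: "d < n \<Longrightarrow> m d = Suc w \<Longrightarrow> flippable v L d w"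
  using m[of d] by auto

lemma rainbow_layered: "rainbow_connected {..<n} E c"
proof -
  obtain d0 where d0: "d0 < n" "outer v d0" "adj x d0" using x_anchored by (auto simp: anchored_def)
  have inner: "L i = 1 \<or> L i = 2 \<longleftrightarrow> adj v i" if "i < n" for i using L_inner_iff[OF that] by simp
  \<comment> \<open>The bounds are included because \<open>m\<close> is specified only on vertices,
    whereas the locale asks that every recoloured pair be an edge.\<close>
  let ?flip = "\<lambda>d w. d < n \<and> w < n \<and> m d = Suc w"
  have "layered {..<n} E v L ?flip c x d0"
  proof
    show "v \<in> {..<n}" using v by simp
    show "L w = 0 \<longleftrightarrow> w = v" if "w \<in> {..<n}" for w using L_zero that by simp
    show "L w \<in> {1, 2} \<longleftrightarrow> {v, w} \<in> E" if "w \<in> {..<n}" for w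
      using L_inner_iff that adj_edge v by simp
    show "L w \<in> {0, 1, 2, 5}" if "w \<in> {..<n}" for w
      using L_range that by simp
    show "{y, z} \<in> E" if "y \<in> {..<n}" "z \<in> {..<n}" "L y = 1" "L z = 1" "y \<noteq> z" for y z
      using X(3)[of y z] L_one[of y] L_one[of z] adj_edge[of y z] that by simp
    show "\<exists>z\<in>{..<n}. L z = 3 - L w \<and> {w, z} \<notin> E"
      if a: "{d, w} \<in> E" "L d = 5" "L w \<in> {1, 2}" for d w
    proof -
      have dw: "d < n" "w < n" "adj w d" using edge_adj[OF a(1)] by auto
      then obtain z where "z < n" "L z = 3 - L w" "\<not> adj w z"
        using X_opposite[of d w] L_outer[of d] inner[of w] a(2,3) by auto
      then show ?thesis using adj_edge dw by auto
    qed
    show "{d0, x} \<in> E" "L d0 = 5"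
      using d0 x_anchored adj_edge edge_sym L_outer by blast+
    show "L x = 1"
      using L_inner[of x] X_anchor x_anchored by (auto simp: anchored_def)
    show "w = w'" if "?flip d w" "?flip d w'" for d w w' using that by simp
    show "\<exists>w'. ?flip d w'"
      if a: "L d = 5" "L w \<in> {1, 2}" "{d, w} \<in> E" "{w, z} \<in> E" "L z = 3 - L w"
        and far: "\<And>z d'. L z = 3 - L w \<Longrightarrow> {d, z} \<notin> E \<and> \<not> (L d' = 5 \<and> {d, d'} \<in> E \<and> {d', z} \<in> E)"
      for d w z
    proof -
      have dw: "d < n" "w < n" "adj d w" "z < n" "adj w z" using edge_adj[OF a(3)] edge_adj[OF a(4)] by auto
      then have "flippable v L d w"
        using a inner[of w] far adj_edge unfolding flippable_def by blast
      then show ?thesis using m[of d] dw by blast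
    qed
    show "L d = 5 \<and> L w \<in> {1, 2} \<and> {d, w} \<in> E \<and> (\<exists>z. {w, z} \<in> E \<and> L z = 3 - L w) \<and>
        (\<forall>z d'. L z = 3 - L w \<longrightarrow> {d, z} \<notin> E \<and> \<not> (L d' = 5 \<and> {d, d'} \<in> E \<and> {d', z} \<in> E))"
      if "?flip d w" for d w
    proof -
      have f: "flippable v L d w" and dw: "d < n" "w < n" using flip_flippable that by auto
      have "\<exists>z. {w, z} \<in> E \<and> L z = 3 - L w" using f dw adj_edge by (auto simp: flippable_def)
      moreover have "{d, z} \<notin> E \<and> \<not> (L d' = 5 \<and> {d, d'} \<in> E \<and> {d', z} \<in> E)" if "L z = 3 - L w" for z d'
        using f that edge_adj unfolding flippable_def by metis
      ultimately show ?thesis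
        using f dw inner[of w] adj_edge by (auto simp: flippable_def)
    qed
    show "c {v, w} = L w" if "{v, w} \<in> E" for w
      using c[of v w] edge_adj[OF that] by (simp add: color_def)
    show "c {w, z} = 5" if "{w, z} \<in> E" "w \<noteq> v" "z \<noteq> v" "L w = 5 \<longleftrightarrow> L z = 5" for w z
      using c[of w z] edge_adj[OF that(1)] that by (auto simp: color_def)
    show "c {d, w} = (if ?flip d w then 5 - L w else 2 + L w)"
      if "{d, w} \<in> E" "L d = 5" "L w \<in> {1, 2}" for d w
      using c[of d w] edge_adj[OF that(1)] that L_root by (auto simp: color_def down_def)
  qed
  then show ?thesis by (rule layered.rainbow)
qed

lemma colors_layered: "c ` E \<subseteq> {1..5}"
proof
  fix k assume "k \<in> c ` E"
  then obtain f where f: "f \<in> E" "k = c f" by auto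
  then obtain u w where uw: "f = {u, w}" using simple by (auto simp: simple_graph_def card_2_iff)
  have V: "u < n" "w < n" "u \<noteq> w" using edge_adj[of u w] f uw by auto
  \<comment> \<open>At most one end is the root, so a root edge takes a nonzero label; an edge to an
    outer vertex takes \<open>2 + s\<close> or \<open>5 - s\<close> for a side
    \<open>s\<close>.\<close>
  have "color v L m u w \<in> {1..5}"
    using L_range[OF V(1)] L_range[OF V(2)] V(3) L_zero[OF V(1)] L_zero[OF V(2)]
    unfolding color_def down_def by auto
  then show "k \<in> {1..5}" using c[OF V] f uw by simp
qed

end

section \<open>The case of a root adjacent to all other vertices\<close>

context
  assumes star: "\<And>d. d < n \<Longrightarrow> \<not> outer v d"
begin

lemma star_adj: "w < n \<Longrightarrow> w \<noteq> v \<Longrightarrow> adj v w"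
  using star by (auto simp: outer_def)

lemma L_star: "w < n \<Longrightarrow> w \<noteq> v \<Longrightarrow> L w = (if leaf v w then (if \<exists>j<n. j < w \<and> leaf v j then 4 else 3)
    else if Z w \<noteq> 0 then 1 else 2)"
proof -
  assume w: "w < n" "w \<noteq> v"
  have "\<not> (\<exists>d<n. outer v d)" using star by blast
  then show ?thesis unfolding L[OF w(1)] labelling_def using w star[OF w(1)] by (simp only: if_False)
qed

lemma colors_star: "c ` E \<subseteq> {1..5}"
proof
  fix k assume "k \<in> c ` E"
  then obtain f where f: "f \<in> E" "k = c f" by auto
  then obtain u w where uw: "f = {u, w}" using simple by (auto simp: simple_graph_def card_2_iff)
  have V: "u < n" "w < n" "u \<noteq> w" using edge_adj[of u w] f uw by auto
  have lab: "L i \<in> {1..4}" if "i < n" "i \<noteq> v" for i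
    using L_star[OF that] by simp
  have "color v L m u w \<in> {1..5}"
    using lab[of u] lab[of w] V L_root unfolding color_def by auto
  then show "k \<in> {1..5}" using c[OF V] f uw by simp
qed

text \<open>Two leaves are joined only through \<open>v\<close>, so their edges differ under
  \<open>c0\<close>; hence there are at most two and their labels differ. Any other vertex has a
  neighbour across the maximal independent set \<open>Z\<close>.\<close>

lemma rainbow_star_graph:
  assumes two: "c0 ` E \<subseteq> {1..2}" "rainbow_connected {..<n} E c0"
  shows "rainbow_connected {..<n} E c"
proof (rule rainbow_star[where v=v and lab=L])
  have leaves: "c0 {v, i} \<noteq> c0 {v, j}" if ij: "i < n" "j < n" "leaf v i" "leaf v j" "i \<noteq> j" for i j
  proof -
    have "i \<noteq> v" "j \<noteq> v" using that adj_irrefl v by (auto simp: leaf_def)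
    then have "{i, j} \<notin> E" using that edge_adj by (auto simp: leaf_def)
    then obtain z where z: "z < n" "{i, z} \<in> E" "{z, j} \<in> E" "c0 {i, z} \<noteq> c0 {z, j}"
      using rainbow_two_colors[OF two, of i j] ij by auto
    then have "z = v" using ij edge_adj[of i z] by (auto simp: leaf_def)
    then show ?thesis using z by (simp add: insert_commute)
  qed
  have range: "c0 {v, i} \<in> {1, 2}" if "i < n" "leaf v i" for i
  proof -
    have "{v, i} \<in> E" using that adj_edge v by (auto simp: leaf_def)
    then have "c0 {v, i} \<in> {1..2}" using two(1) by blast
    then show ?thesis by auto
  qed
  show "\<exists>y. y \<noteq> v \<and> {w, y} \<in> E \<and> L y \<noteq> L w"
    if wz: "w \<in> {..<n}" "z \<in> {..<n}" "w \<noteq> v" "z \<noteq> v" "w \<noteq> z" "{w, z} \<notin> E" "L w = L z" for w z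
  proof (cases "leaf v w")
    case True
    then have lz: "leaf v z" using L_star[of w] L_star[of z] wz by (auto split: if_splits)
    \<comment> \<open>The later leaf \<open>j\<close> has label 4. Equal labels would give
      \<open>i\<close> a smaller leaf \<open>k\<close>, and three leaf edges would need pairwise
      different values in \<open>{1, 2}\<close>.\<close>
    have False if ij: "i < j" "i < n" "j < n" "leaf v i" "leaf v j" "L i = L j" for i j
    proof -
      have "i \<noteq> v" "j \<noteq> v" using ij adj_irrefl v by (auto simp: leaf_def)
      then obtain k where "k < i" "leaf v k"
        using L_star[of i] L_star[of j] ij by (auto split: if_splits)
      then show False
        using leaves[of k i] leaves[of k j] leaves[of i j] range[of k] range[of i] range[of j] ij by auto
    qed
    from this[of w z] this[of z w] show ?thesis
      using True lz wz by (metis lessThan_iff linorder_neqE_nat)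
  next
    case False
    then obtain j where j: "j < n" "j \<noteq> v" "adj w j"
      using star_adj[of w] wz by (auto simp: leaf_def)
    \<comment> \<open>A neighbour of \<open>w\<close> has a neighbour other than \<open>v\<close>,
      so its label comes from \<open>Z\<close> and not from the leaf rule.\<close>
    have nl: "\<not> leaf v i" if "i < n" "adj w i" for i
      using adj_sym[of w i] that wz by (auto simp: leaf_def)
    show ?thesis
    \<comment> \<open>Outside \<open>Z\<close>, maximality provides a neighbour in \<open>Z\<close>;
      inside it, independence puts every neighbour outside.\<close>
    proof (cases "Z w = 0")
      case True
      then obtain i where i: "i < n" "Z i \<noteq> 0" "adj w i" using Z(1)[of w] star_adj[of w] wz by auto
      then have "i \<noteq> v" using Z(2)[of i] adj_irrefl v by auto
      then show ?thesis
        using i nl[of i] L_star[of i] L_star[of w] True False wz adj_edge by (intro exI[of _ i]) auto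
    next
      case Zw: False
      have "Z j = 0" using Z(3)[of w j] Zw j wz adj_irrefl by auto
      then show ?thesis
        using j nl[of j] L_star[of j] L_star[of w] Zw False wz adj_edge by (intro exI[of _ j]) auto
    qed
  qed
  show "{v, w} \<in> E \<and> c {v, w} = L w \<and> L w < 5" if "w \<in> {..<n}" "w \<noteq> v" for w
    using that star_adj[of w] adj_edge[of v w] v c[of v w] L_star[of w] by (auto simp: color_def)
  show "c {w, z} = 5" if "{w, z} \<in> E" "w \<noteq> v" "z \<noteq> v" for w z
  proof -
    have "L w \<noteq> 5" "L z \<noteq> 5" using edge_adj[OF that(1)] L_outer star by auto
    then show ?thesis using c[of w z] edge_adj[OF that(1)] that by (simp add: color_def)
  qed
qed (use v in simp)

end

end

text \<open>The output is read only at the entry with the smaller vertex first; symmetry makes that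
  entry the colour for either order.\<close>

lemma (in adjacency_matrix) color_sym: "u \<noteq> w \<Longrightarrow> color v L m u w = color v L m w u"
  by (auto simp: color_def)

lemma program_colors_graph:
  assumes simple: "simple_graph {..<n} E" and conn: "connected_graph {..<n} E" and rc: "rc {..<n} E = 2"
    and s: "\<And>a. a < 10 \<Longrightarrow> s a = sem program (input n E) (\<lambda>_. n) a"
  shows "output_coloring n s ` E \<subseteq> {1..5} \<and> rainbow_connected {..<n} E (output_coloring n s)"
proof -
  obtain c0 where c0: "c0 ` E \<subseteq> {1..2}" "rainbow_connected {..<n} E c0"
    using rc_attained[OF simple conn] rc by auto
  have n: "0 < n" using conn by (auto simp: connected_graph_def)
  interpret diameter_two "{..<n}" E
    using simple rainbow_two_colors[OF c0] by unfold_locales blast+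
  interpret adjacency_matrix n "input n E 1"
  proof
    show "input n E 1 i \<le> 1" for i by (simp add: input_def)
    show "input n E 1 (n * j + i) \<noteq> 0" if "i < n" "j < n" "input n E 1 (n * i + j) \<noteq> 0" for i j
      using that input_index[OF simple] edge_sym by blast
  qed
  have loaded: "loaded (input n E)" unfolding loaded_def by (simp add: input_def)
  have zero: "input n E a = (\<lambda>_. 0)" if "a > 1" for a
    using that by (simp add: input_def fun_eq_iff)
  obtain v x X Z L m where r: "v < n" "\<forall>j<n. deg j \<le> deg v"
    "(\<exists>i<n. anchored v i) \<longrightarrow> x < n \<and> anchored v x"
    "x < n \<longrightarrow> X x \<noteq> (0::nat)"
    "\<forall>i<n. (X i \<noteq> 0 \<longrightarrow> i = x \<or> adj v i) \<and>
      (adj v i \<longrightarrow> X i \<noteq> 0 \<or> (\<exists>j<n. X j \<noteq> 0 \<and> \<not> adj i j)) \<and>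
      (\<forall>j<n. i \<noteq> j \<and> X i \<noteq> 0 \<and> X j \<noteq> 0 \<longrightarrow> adj i j)"
    "\<forall>i<n. (adj v i \<longrightarrow> Z i \<noteq> 0 \<or> (\<exists>j<n. Z j \<noteq> 0 \<and> adj i j)) \<and> (Z i \<noteq> (0::nat) \<longrightarrow> adj v i) \<and>
      (\<forall>j<n. i \<noteq> j \<and> Z i \<noteq> 0 \<and> Z j \<noteq> 0 \<longrightarrow> \<not> adj i j)"
    "\<forall>i<n. L i = labelling v X Z i"
    "\<forall>i<n. (\<exists>j<n. flippable v L i j \<and> m i = Suc j) \<or> (\<forall>j<n. \<not> flippable v L i j) \<and> m i = 0"
    and out: "\<forall>u<n. \<forall>w<n. sem program (input n E) (\<lambda>_. n) 2 (n * u + w) = color v L m u w"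
    by (rule program_result[where s="input n E" and \<sigma>="\<lambda>_. n", OF loaded n zero]) (assumption, rule that)
  have c: "output_coloring n s {u, w} = color v L m u w" if "u < n" "w < n" "u \<noteq> w" for u w
  proof -
    have "output_coloring n s {u, w} = sem program (input n E) (\<lambda>_. n) 2 (n * min u w + max u w)"
      using s[of 2] by (simp add: output_coloring_def mult.commute[of n])
    also have "\<dots> = color v L m (min u w) (max u w)"
      using out that by (simp add: min_def max_def)
    also have "\<dots> = color v L m u w"
      using color_sym[OF that(3)] by (simp add: min_def max_def)
    finally show ?thesis .
  qed
  interpret solved_graph n E "input n E 1" v x X Z L m "output_coloring n s"
  proof
    show "input n E 1 (n * i + j) \<noteq> 0 \<longleftrightarrow> {i, j} \<in> E" if "i < n" "j < n" for i j
      using input_index[OF simple that] .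
    show "v < n" by (rule r(1))
    show "deg j \<le> deg v" if "j < n" for j
      using r(2) that by simp
    show "x < n \<and> anchored v x" if "\<exists>i<n. anchored v i"
      using r(3) that by simp
    show "X x \<noteq> 0" if "x < n"
      using r(4) that by simp
    show "i = x \<or> adj v i" if "i < n" "X i \<noteq> 0" for i
      using r(5) that by blast
    show "X i \<noteq> 0 \<or> (\<exists>j<n. X j \<noteq> 0 \<and> \<not> adj i j)" if "i < n" "adj v i" for i
      using r(5) that by blast
    show "adj i j" if "i < n" "j < n" "i \<noteq> j" "X i \<noteq> 0" "X j \<noteq> 0" for i j
      using r(5) that by blast
    show "Z i \<noteq> 0 \<or> (\<exists>j<n. Z j \<noteq> 0 \<and> adj i j)" if "i < n" "adj v i" for i
      using r(6) that by blast
    show "adj v i" if "i < n" "Z i \<noteq> 0" for i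
      using r(6) that by blast
    show "\<not> adj i j" if "i < n" "j < n" "i \<noteq> j" "Z i \<noteq> 0" "Z j \<noteq> 0" for i j
      using r(6) that by blast
    show "L i = labelling v X Z i" if "i < n" for i
      using r(7) that by blast
    show "(\<exists>j<n. flippable v L i j \<and> m i = Suc j) \<or> (\<forall>j<n. \<not> flippable v L i j) \<and> m i = 0"
      if "i < n" for i
      using r(8) that by blast
  qed (use c in blast)
  show ?thesis
  proof (cases "\<exists>d<n. outer v d")
    case True
    then show ?thesis using rainbow_layered colors_layered by blast
  next
    case False
    then show ?thesis using rainbow_star_graph[OF _ c0] colors_star by blast
  qed
qed

theorem theorem1:
  "\<exists>(p :: com) (q :: nat poly). \<forall>(n :: nat) (E :: nat set set).
     simple_graph {..<n} E \<and> connected_graph {..<n} E \<and> rc {..<n} E = 2 \<longrightarrow>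
       (\<exists>t s. exec p (input n E) t s \<and> t \<le> poly q n \<and>
          output_coloring n s ` E \<subseteq> {1..5} \<and>
          rainbow_connected {..<n} E (output_coloring n s))"
\<comment> \<open>Every source variable initially lives in cell 0 of array 0 and so has value
  \<open>n\<close>; the environment constantly \<open>n\<close> matches this.\<close>
proof (rule exI[of _ "compile_stmt (\<lambda>_. 0) 10 program"], rule exI[of _ "stmt_time program"], intro allI impI)
  fix n :: nat and E :: "nat set set"
  assume G: "simple_graph {..<n} E \<and> connected_graph {..<n} E \<and> rc {..<n} E = 2"
  have "input n E 0 0 = n" by (simp add: input_def)
  then have "halts (compile_stmt (\<lambda>_. 0) 10 program) (input n E) (poly (stmt_time program) n)
      (\<lambda>s. \<forall>a<10. s a = sem program (input n E) (\<lambda>_. n) a)"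
    using halts_compile_stmt[of 10 "\<lambda>_. 0" program "input n E" "\<lambda>_. n"] program_arrays by auto
  then obtain t s where "exec (compile_stmt (\<lambda>_. 0) 10 program) (input n E) t s"
    "t \<le> poly (stmt_time program) n" "\<forall>a<10. s a = sem program (input n E) (\<lambda>_. n) a"
    unfolding halts_def by blast
  with program_colors_graph[of n E s] G
  show "\<exists>t s. exec (compile_stmt (\<lambda>_. 0) 10 program) (input n E) t s \<and> t \<le> poly (stmt_time program) n \<and>
      output_coloring n s ` E \<subseteq> {1..5} \<and> rainbow_connected {..<n} E (output_coloring n s)"
    by blast
qed

end
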